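(* Let $A$ and $X$ be sets. The free $A$-multi-Novikov algebra $\mathrm{Nov}_A\langle X\rangle$ generated by $X$ is isomorphic to the $A$-multi-Novikov subalgebra generated by $X$ of the free commutative multidifferential algebra $\mathrm{CD}_A\langle X\rangle$, where $\mathrm{CD}_A\langle X\rangle$ is considered with its canonical multi-Novikov structure.
   Context: Vector spaces are over a fixed field. $\mathbb{N}=\{0,1,2,\dots\}$. An $A$-multi-Novikov algebra is a vector space with bilinear products $x,y\mapsto x\triangleright_a y$, $a\in A$, satisfying for all $a,b\in A$ and all $x,y,z$: (1) $(x\triangleright_a y)\triangleright_b z-x\triangleright_a(y\triangleright_b z)=(y\triangleright_a x)\triangleright_b z-y\triangleright_a(x\triangleright_b z)$; (2) $(x\triangleright_a y)\triangleright_b z-x\triangleright_a(y\triangleright_b z)=(x\triangleright_b y)\triangleright_a z-x\triangleright_b(y\triangleright_a z)$; (3) $(x\triangleright_a y)\triangleright_b z=(x\triangleright_b z)\triangleright_a y$. A commutative multidifferential algebra (with respect to $A$) is a vector space $R$ with a commutative associative product and pairwise commuting derivations $\partial_a$, $a\in A$, of this product. Its canonical multi-Novikov structure is given by $x\triangleright_a y:=x\,\partial_a(y)$; this is an $A$-multi-Novikov structure. The free commutative multidifferential algebra $\mathrm{CD}_A\langle X\rangle$ is the polynomial algebra on the set of variables $X\times M(A)$, where $M(A)$ is the set of finitely supported maps $m\colon A\to\mathbb{N}$, with derivations determined by $\partial_a(x,m)=(x,m_a)$, $m_a(a')=m(a')+\delta_{a,a'}$. The set $X$ is embedded via $x\mapsto(x,0)$,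 so that $(x,m)=\prod_{a\in A}\partial_a^{m(a)}(x)$. *)

theory Defs
  imports "HOL-Algebra.Module" "HOL-Library.Poly_Mapping"
begin

section \<open>Multi-Novikov algebras\<close>

definition field_ring :: "'k::field ring" where
  "field_ring = \<lparr>carrier = UNIV, mult = (*), one = 1, zero = 0, add = (+)\<rparr>"

lemma field_ring_simps [simp]:
  "carrier (field_ring :: 'k::field ring) = UNIV"
  "mult (field_ring :: 'k ring) = (*)"
  "one (field_ring :: 'k ring) = 1"
  "zero (field_ring :: 'k ring) = 0"
  "add (field_ring :: 'k ring) = (+)"
  by (simp_all add: field_ring_def)

lemma field_field_ring: "field (field_ring :: 'k::field ring)"
proof (rule cring.cring_fieldI)
  show "cring (field_ring :: 'k::field ring)"
  proof (rule cringI)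
    show "abelian_group (field_ring :: 'k ring)"
    proof (rule abelian_groupI)
      show "\<exists>y\<in>carrier field_ring. y \<oplus>\<^bsub>field_ring\<^esub> x = \<zero>\<^bsub>field_ring\<^esub>" for x :: 'k
        by (intro bexI[of _ "- x"]) simp_all
    qed (simp_all add: ac_simps)
    show "comm_monoid (field_ring :: 'k ring)"
      by (rule comm_monoidI) (simp_all add: ac_simps)
  qed (simp add: distrib_right)
  have "\<exists>y. y * x = 1 \<and> x * y = 1" if "x \<noteq> 0" for x :: 'k
    using that by (intro exI[of _ "inverse x"]) simp
  then show "Units (field_ring :: 'k ring) = carrier field_ring - {\<zero>\<^bsub>field_ring\<^esub>}"
    by (auto simp: Units_def)
qed

lemma cring_field_ring: "cring (field_ring :: 'k::field ring)"
  using field_field_ring unfolding field_def domain_def by blast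

text \<open>The fields \<open>mult\<close> and \<open>one\<close> inherited from the record of modules
  carry no meaning in a \<open>multi_alg\<close>.\<close>

record ('k, 'v, 'a) multi_alg = "('k, 'v) module" +
  tri :: "'a \<Rightarrow> 'v \<Rightarrow> 'v \<Rightarrow> 'v"

locale multi_novikov = module field_ring V
  for A :: "'a set" and V :: "('k::field, 'v, 'a) multi_alg" (structure) +
  assumes tri_closed:
      "\<lbrakk>a \<in> A; x \<in> carrier V; y \<in> carrier V\<rbrakk> \<Longrightarrow> tri V a x y \<in> carrier V"
    and tri_add_left:
      "\<lbrakk>a \<in> A; x \<in> carrier V; y \<in> carrier V; z \<in> carrier V\<rbrakk>
        \<Longrightarrow> tri V a (x \<oplus> y) z = tri V a x z \<oplus> tri V a y z"
    and tri_add_right: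
      "\<lbrakk>a \<in> A; x \<in> carrier V; y \<in> carrier V; z \<in> carrier V\<rbrakk>
        \<Longrightarrow> tri V a x (y \<oplus> z) = tri V a x y \<oplus> tri V a x z"
    and tri_smult_left:
      "\<lbrakk>a \<in> A; x \<in> carrier V; y \<in> carrier V\<rbrakk>
        \<Longrightarrow> tri V a (c \<odot> x) y = c \<odot> tri V a x y"
    and tri_smult_right:
      "\<lbrakk>a \<in> A; x \<in> carrier V; y \<in> carrier V\<rbrakk>
        \<Longrightarrow> tri V a x (c \<odot> y) = c \<odot> tri V a x y"
    and novikov1:
      "\<lbrakk>a \<in> A; b \<in> A; x \<in> carrier V; y \<in> carrier V; z \<in> carrier V\<rbrakk>
        \<Longrightarrow> tri V b (tri V a x y) z \<ominus> tri V a x (tri V b y z)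
          = tri V b (tri V a y x) z \<ominus> tri V a y (tri V b x z)"
    and novikov2:
      "\<lbrakk>a \<in> A; b \<in> A; x \<in> carrier V; y \<in> carrier V; z \<in> carrier V\<rbrakk>
        \<Longrightarrow> tri V b (tri V a x y) z \<ominus> tri V a x (tri V b y z)
          = tri V a (tri V b x y) z \<ominus> tri V b x (tri V a y z)"
    and novikov3:
      "\<lbrakk>a \<in> A; b \<in> A; x \<in> carrier V; y \<in> carrier V; z \<in> carrier V\<rbrakk>
        \<Longrightarrow> tri V b (tri V a x y) z = tri V a (tri V b x z) y"

definition mn_hom ::
  "'a set \<Rightarrow> ('k::field, 'v, 'a) multi_alg \<Rightarrow> ('k, 'w, 'a) multi_alg \<Rightarrow> ('v \<Rightarrow> 'w) set" where
  "mn_hom A V W = {h. h \<in> carrier V \<rightarrow> carrier W \<and>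
     (\<forall>x\<in>carrier V. \<forall>y\<in>carrier V. h (x \<oplus>\<^bsub>V\<^esub> y) = h x \<oplus>\<^bsub>W\<^esub> h y) \<and>
     (\<forall>c. \<forall>x\<in>carrier V. h (c \<odot>\<^bsub>V\<^esub> x) = c \<odot>\<^bsub>W\<^esub> h x) \<and>
     (\<forall>a\<in>A. \<forall>x\<in>carrier V. \<forall>y\<in>carrier V. h (tri V a x y) = tri W a (h x) (h y))}"

definition mn_iso ::
  "'a set \<Rightarrow> ('k::field, 'v, 'a) multi_alg \<Rightarrow> ('k, 'w, 'a) multi_alg \<Rightarrow> ('v \<Rightarrow> 'w) set" where
  "mn_iso A V W = {h \<in> mn_hom A V W. bij_betw h (carrier V) (carrier W)}"

definition mn_subalgebra :: "'a set \<Rightarrow> 'v set \<Rightarrow> ('k::field, 'v, 'a) multi_alg \<Rightarrow> bool" where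
  "mn_subalgebra A S V \<longleftrightarrow> submodule S field_ring V \<and>
     (\<forall>a\<in>A. \<forall>x\<in>S. \<forall>y\<in>S. tri V a x y \<in> S)"

definition mn_generated ::
  "'a set \<Rightarrow> ('k::field, 'v, 'a) multi_alg \<Rightarrow> 'v set \<Rightarrow> ('k, 'v, 'a) multi_alg" where
  "mn_generated A V G = V\<lparr>carrier := \<Inter>{S. mn_subalgebra A S V \<and> G \<subseteq> S}\<rparr>"


section \<open>The free multi-Novikov algebra\<close>

text \<open>The free algebra of the variety of multi-Novikov algebras: formal terms in the
  generators, modulo the smallest congruence that contains the vector space axioms,
  bilinearity of the products, and the three defining identities. It is shown below to be a
  multi-Novikov algebra with the universal property of a free one.\<close>

datatype ('k, 'a, 'x) nov_term =
    Gen 'x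
  | Zero
  | Plus "('k, 'a, 'x) nov_term" "('k, 'a, 'x) nov_term"
  | Scale 'k "('k, 'a, 'x) nov_term"
  | Tri 'a "('k, 'a, 'x) nov_term" "('k, 'a, 'x) nov_term"

abbreviation Minus ::
  "('k::field, 'a, 'x) nov_term \<Rightarrow> ('k, 'a, 'x) nov_term \<Rightarrow> ('k, 'a, 'x) nov_term" where
  "Minus s t \<equiv> Plus s (Scale (- 1) t)"

inductive_set nov_terms :: "'a set \<Rightarrow> 'x set \<Rightarrow> ('k::field, 'a, 'x) nov_term set"
  for A :: "'a set" and X :: "'x set" where
  Gen: "x \<in> X \<Longrightarrow> Gen x \<in> nov_terms A X"
| Zero: "Zero \<in> nov_terms A X"
| Plus: "\<lbrakk>s \<in> nov_terms A X; t \<in> nov_terms A X\<rbrakk> \<Longrightarrow> Plus s t \<in> nov_terms A X"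
| Scale: "s \<in> nov_terms A X \<Longrightarrow> Scale c s \<in> nov_terms A X"
| Tri: "\<lbrakk>a \<in> A; s \<in> nov_terms A X; t \<in> nov_terms A X\<rbrakk> \<Longrightarrow> Tri a s t \<in> nov_terms A X"

inductive nov_eq ::
  "'a set \<Rightarrow> 'x set \<Rightarrow> ('k::field, 'a, 'x) nov_term \<Rightarrow> ('k, 'a, 'x) nov_term \<Rightarrow> bool"
  for A :: "'a set" and X :: "'x set" where
  refl: "s \<in> nov_terms A X \<Longrightarrow> nov_eq A X s s"
| sym: "nov_eq A X s t \<Longrightarrow> nov_eq A X t s"
| trans: "\<lbrakk>nov_eq A X s t; nov_eq A X t u\<rbrakk> \<Longrightarrow> nov_eq A X s u"
| cong_Plus: "\<lbrakk>nov_eq A X s s'; nov_eq A X t t'\<rbrakk> \<Longrightarrow> nov_eq A X (Plus s t) (Plus s' t')"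
| cong_Scale: "nov_eq A X s s' \<Longrightarrow> nov_eq A X (Scale c s) (Scale c s')"
| cong_Tri: "\<lbrakk>a \<in> A; nov_eq A X s s'; nov_eq A X t t'\<rbrakk>
    \<Longrightarrow> nov_eq A X (Tri a s t) (Tri a s' t')"
| plus_assoc: "\<lbrakk>s \<in> nov_terms A X; t \<in> nov_terms A X; u \<in> nov_terms A X\<rbrakk>
    \<Longrightarrow> nov_eq A X (Plus (Plus s t) u) (Plus s (Plus t u))"
| plus_comm: "\<lbrakk>s \<in> nov_terms A X; t \<in> nov_terms A X\<rbrakk>
    \<Longrightarrow> nov_eq A X (Plus s t) (Plus t s)"
| plus_zero: "s \<in> nov_terms A X \<Longrightarrow> nov_eq A X (Plus Zero s) s"
| plus_minus: "s \<in> nov_terms A X \<Longrightarrow> nov_eq A X (Minus s s) Zero"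
| scale_plus_left: "s \<in> nov_terms A X
    \<Longrightarrow> nov_eq A X (Scale (c + d) s) (Plus (Scale c s) (Scale d s))"
| scale_plus_right: "\<lbrakk>s \<in> nov_terms A X; t \<in> nov_terms A X\<rbrakk>
    \<Longrightarrow> nov_eq A X (Scale c (Plus s t)) (Plus (Scale c s) (Scale c t))"
| scale_scale: "s \<in> nov_terms A X \<Longrightarrow> nov_eq A X (Scale (c * d) s) (Scale c (Scale d s))"
| scale_one: "s \<in> nov_terms A X \<Longrightarrow> nov_eq A X (Scale 1 s) s"
| tri_plus_left: "\<lbrakk>a \<in> A; s \<in> nov_terms A X; t \<in> nov_terms A X; u \<in> nov_terms A X\<rbrakk>
    \<Longrightarrow> nov_eq A X (Tri a (Plus s t) u) (Plus (Tri a s u) (Tri a t u))"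
| tri_plus_right: "\<lbrakk>a \<in> A; s \<in> nov_terms A X; t \<in> nov_terms A X; u \<in> nov_terms A X\<rbrakk>
    \<Longrightarrow> nov_eq A X (Tri a s (Plus t u)) (Plus (Tri a s t) (Tri a s u))"
| tri_scale_left: "\<lbrakk>a \<in> A; s \<in> nov_terms A X; t \<in> nov_terms A X\<rbrakk>
    \<Longrightarrow> nov_eq A X (Tri a (Scale c s) t) (Scale c (Tri a s t))"
| tri_scale_right: "\<lbrakk>a \<in> A; s \<in> nov_terms A X; t \<in> nov_terms A X\<rbrakk>
    \<Longrightarrow> nov_eq A X (Tri a s (Scale c t)) (Scale c (Tri a s t))"
| nov1: "\<lbrakk>a \<in> A; b \<in> A; x \<in> nov_terms A X; y \<in> nov_terms A X; z \<in> nov_terms A X\<rbrakk>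
    \<Longrightarrow> nov_eq A X (Minus (Tri b (Tri a x y) z) (Tri a x (Tri b y z)))
                  (Minus (Tri b (Tri a y x) z) (Tri a y (Tri b x z)))"
| nov2: "\<lbrakk>a \<in> A; b \<in> A; x \<in> nov_terms A X; y \<in> nov_terms A X; z \<in> nov_terms A X\<rbrakk>
    \<Longrightarrow> nov_eq A X (Minus (Tri b (Tri a x y) z) (Tri a x (Tri b y z)))
                  (Minus (Tri a (Tri b x y) z) (Tri b x (Tri a y z)))"
| nov3: "\<lbrakk>a \<in> A; b \<in> A; x \<in> nov_terms A X; y \<in> nov_terms A X; z \<in> nov_terms A X\<rbrakk>
    \<Longrightarrow> nov_eq A X (Tri b (Tri a x y) z) (Tri a (Tri b x z) y)"

definition nov_rel ::
  "'a set \<Rightarrow> 'x set \<Rightarrow> (('k::field, 'a, 'x) nov_term \<times> ('k, 'a, 'x) nov_term) set" where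
  "nov_rel A X = {(s, t). nov_eq A X s t}"

definition nov_class ::
  "'a set \<Rightarrow> 'x set \<Rightarrow> ('k::field, 'a, 'x) nov_term \<Rightarrow> ('k, 'a, 'x) nov_term set" where
  "nov_class A X t = nov_rel A X `` {t}"

definition Nov ::
  "'a set \<Rightarrow> 'x set \<Rightarrow> ('k::field, ('k, 'a, 'x) nov_term set, 'a) multi_alg" where
  "Nov A X = \<lparr>carrier = nov_terms A X // nov_rel A X,
     mult = undefined, one = undefined,
     zero = nov_class A X Zero,
     add = (\<lambda>C D. \<Union>s\<in>C. \<Union>t\<in>D. nov_class A X (Plus s t)),
     smult = (\<lambda>c C. \<Union>s\<in>C. nov_class A X (Scale c s)),
     tri = (\<lambda>a C D. \<Union>s\<in>C. \<Union>t\<in>D. nov_class A X (Tri a s t))\<rparr>"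

definition nov_gen :: "'a set \<Rightarrow> 'x set \<Rightarrow> 'x \<Rightarrow> ('k::field, 'a, 'x) nov_term set" where
  "nov_gen A X x = nov_class A X (Gen x)"

lemma nov_eq_terms:
  "nov_eq A X s t \<Longrightarrow> s \<in> nov_terms A X \<and> t \<in> nov_terms A X"
  by (induction rule: nov_eq.induct) (auto intro: nov_terms.intros)

lemma equiv_nov_rel: "equiv (nov_terms A X) (nov_rel A X)"
proof (rule equivI)
  show "nov_rel A X \<subseteq> nov_terms A X \<times> nov_terms A X"
    using nov_eq_terms by (auto simp: nov_rel_def)
  show "refl_on (nov_terms A X) (nov_rel A X)"
    by (simp add: refl_on_def nov_rel_def nov_eq.refl)
  show "sym (nov_rel A X)"
    unfolding sym_def nov_rel_def using nov_eq.sym by blast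
  show "trans (nov_rel A X)"
    unfolding trans_def nov_rel_def using nov_eq.trans by blast
qed

lemma nov_class_eqI: "nov_eq A X s t \<Longrightarrow> nov_class A X s = nov_class A X t"
  unfolding nov_class_def by (rule equiv_class_eq[OF equiv_nov_rel]) (simp add: nov_rel_def)

lemma Nov_carrier_iff:
  "C \<in> carrier (Nov A X) \<longleftrightarrow> (\<exists>t\<in>nov_terms A X. C = nov_class A X t)"
  by (auto simp: Nov_def quotient_def nov_class_def)

lemma nov_class_closed: "t \<in> nov_terms A X \<Longrightarrow> nov_class A X t \<in> carrier (Nov A X)"
  by (auto simp: Nov_carrier_iff)

lemma Nov_carrierE:
  assumes "C \<in> carrier (Nov A X)"
  obtains t where "t \<in> nov_terms A X" "C = nov_class A X t"
  using assms by (auto simp: Nov_carrier_iff)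

lemma mem_nov_class_self: "t \<in> nov_terms A X \<Longrightarrow> t \<in> nov_class A X t"
  by (simp add: nov_class_def nov_rel_def nov_eq.refl)

lemma mem_nov_classD: "s \<in> nov_class A X t \<Longrightarrow> nov_eq A X t s"
  by (simp add: nov_class_def nov_rel_def)

lemma Nov_zero: "\<zero>\<^bsub>Nov A X\<^esub> = nov_class A X Zero"
  by (simp add: Nov_def)

lemma UN_const: "\<lbrakk>c \<in> C; \<And>x. x \<in> C \<Longrightarrow> f x = K\<rbrakk> \<Longrightarrow> (\<Union>x\<in>C. f x) = K"
  by blast

lemma Nov_add:
  assumes "s \<in> nov_terms A X" "t \<in> nov_terms A X"
  shows "nov_class A X s \<oplus>\<^bsub>Nov A X\<^esub> nov_class A X t = nov_class A X (Plus s t)"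
proof -
  have "(\<Union>s'\<in>nov_class A X s. \<Union>t'\<in>nov_class A X t. nov_class A X (Plus s' t'))
      = nov_class A X (Plus s t)"
    by (rule UN_const[OF mem_nov_class_self[OF assms(1)]],
        rule UN_const[OF mem_nov_class_self[OF assms(2)]])
      (intro nov_class_eqI[OF nov_eq.sym] nov_eq.cong_Plus mem_nov_classD)
  then show ?thesis by (simp add: Nov_def)
qed

lemma Nov_smult:
  assumes "s \<in> nov_terms A X"
  shows "c \<odot>\<^bsub>Nov A X\<^esub> nov_class A X s = nov_class A X (Scale c s)"
proof -
  have "(\<Union>s'\<in>nov_class A X s. nov_class A X (Scale c s')) = nov_class A X (Scale c s)"
    by (rule UN_const[OF mem_nov_class_self[OF assms(1)]])
      (intro nov_class_eqI[OF nov_eq.sym] nov_eq.cong_Scale mem_nov_classD)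
  then show ?thesis by (simp add: Nov_def)
qed

lemma Nov_tri:
  assumes "a \<in> A" "s \<in> nov_terms A X" "t \<in> nov_terms A X"
  shows "tri (Nov A X) a (nov_class A X s) (nov_class A X t) = nov_class A X (Tri a s t)"
proof -
  have "(\<Union>s'\<in>nov_class A X s. \<Union>t'\<in>nov_class A X t. nov_class A X (Tri a s' t'))
      = nov_class A X (Tri a s t)"
    by (rule UN_const[OF mem_nov_class_self[OF assms(2)]],
        rule UN_const[OF mem_nov_class_self[OF assms(3)]])
      (intro nov_class_eqI[OF nov_eq.sym] nov_eq.cong_Tri mem_nov_classD assms(1))
  then show ?thesis by (simp add: Nov_def)
qed

lemma Nov_module:
  fixes A :: "'a set" and X :: "'x set"
  shows "module field_ring (Nov A X :: ('k::field, _, _) multi_alg)" (is "module _ ?N")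
proof (rule moduleI)
  note [simp] = Nov_zero Nov_add Nov_smult nov_terms.intros nov_class_closed
  show "cring (field_ring :: 'k ring)"
    by (rule cring_field_ring)
  show "abelian_group ?N"
  proof (rule abelian_groupI)
    show "\<zero>\<^bsub>?N\<^esub> \<in> carrier ?N"
      by simp
    fix x y z
    assume "x \<in> carrier ?N"
    then obtain s where s: "s \<in> nov_terms A X" and x: "x = nov_class A X s"
      by (rule Nov_carrierE)
    have "nov_eq A X (Plus (Scale (- 1) s) s) Zero"
      using s by (blast intro: nov_eq.intros nov_terms.intros)
    with s show "\<exists>y\<in>carrier ?N. y \<oplus>\<^bsub>?N\<^esub> x = \<zero>\<^bsub>?N\<^esub>"
      by (intro bexI[of _ "nov_class A X (Scale (- 1) s)"]) (simp_all add: x nov_class_eqI)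
    show "\<zero>\<^bsub>?N\<^esub> \<oplus>\<^bsub>?N\<^esub> x = x"
      using s nov_class_eqI[OF nov_eq.plus_zero, OF s] by (simp add: x)
    assume "y \<in> carrier ?N"
    then obtain t where t: "t \<in> nov_terms A X" and y: "y = nov_class A X t"
      by (rule Nov_carrierE)
    show "x \<oplus>\<^bsub>?N\<^esub> y \<in> carrier ?N"
      using s t by (simp add: x y)
    show "x \<oplus>\<^bsub>?N\<^esub> y = y \<oplus>\<^bsub>?N\<^esub> x"
      using s t nov_class_eqI[OF nov_eq.plus_comm, OF s t] by (simp add: x y)
    assume "z \<in> carrier ?N"
    then obtain u where u: "u \<in> nov_terms A X" and z: "z = nov_class A X u"
      by (rule Nov_carrierE)
    show "(x \<oplus>\<^bsub>?N\<^esub> y) \<oplus>\<^bsub>?N\<^esub> z = x \<oplus>\<^bsub>?N\<^esub> (y \<oplus>\<^bsub>?N\<^esub> z)"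
      using s t u nov_class_eqI[OF nov_eq.plus_assoc, OF s t u] by (simp add: x y z)
  qed
next
  note [simp] = Nov_add Nov_smult nov_terms.intros nov_class_closed
  fix c d :: 'k and x y
  assume "x \<in> carrier ?N"
  then obtain s where s: "s \<in> nov_terms A X" and x: "x = nov_class A X s"
    by (rule Nov_carrierE)
  show "c \<odot>\<^bsub>?N\<^esub> x \<in> carrier ?N"
    using s by (simp add: x)
  show "(c \<oplus>\<^bsub>field_ring\<^esub> d) \<odot>\<^bsub>?N\<^esub> x = c \<odot>\<^bsub>?N\<^esub> x \<oplus>\<^bsub>?N\<^esub> d \<odot>\<^bsub>?N\<^esub> x"
    using s by (simp add: x nov_class_eqI[OF nov_eq.scale_plus_left])
  show "(c \<otimes>\<^bsub>field_ring\<^esub> d) \<odot>\<^bsub>?N\<^esub> x = c \<odot>\<^bsub>?N\<^esub> (d \<odot>\<^bsub>?N\<^esub> x)"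
    using s by (simp add: x nov_class_eqI[OF nov_eq.scale_scale])
  show "\<one>\<^bsub>field_ring\<^esub> \<odot>\<^bsub>?N\<^esub> x = x"
    using s by (simp add: x nov_class_eqI[OF nov_eq.scale_one])
  assume "y \<in> carrier ?N"
  then obtain t where t: "t \<in> nov_terms A X" and y: "y = nov_class A X t"
    by (rule Nov_carrierE)
  show "c \<odot>\<^bsub>?N\<^esub> (x \<oplus>\<^bsub>?N\<^esub> y) = c \<odot>\<^bsub>?N\<^esub> x \<oplus>\<^bsub>?N\<^esub> c \<odot>\<^bsub>?N\<^esub> y"
    using s t by (simp add: x y nov_class_eqI[OF nov_eq.scale_plus_right])
qed

lemma module_minus_eq:
  fixes V :: "('k::field, 'v, 'b) module_scheme" (structure)
  assumes "module field_ring V" "x \<in> carrier V" "y \<in> carrier V"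
  shows "x \<ominus> y = x \<oplus> (- 1) \<odot> y"
proof -
  interpret module field_ring V by fact
  have "((- 1) \<odot> y) \<oplus> y = \<zero>"
    using smult_l_distr[of "- 1" 1 y] smult_one[of y] smult_l_null[of y] assms by simp
  with assms have "(- 1) \<odot> y = \<ominus> y"
    by (intro M.minus_equality[symmetric]) (auto simp: smult_closed)
  then show ?thesis by (simp add: a_minus_def)
qed

theorem Nov_multi_novikov:
  fixes A :: "'a set" and X :: "'x set"
  shows "multi_novikov A (Nov A X :: ('k::field, _, _) multi_alg)" (is "multi_novikov A ?N")
proof (rule multi_novikov.intro[OF Nov_module], rule multi_novikov_axioms.intro)
  note [simp] = Nov_add Nov_smult Nov_tri nov_terms.intros nov_class_closed
  have [simp]: "nov_class A X s \<ominus>\<^bsub>?N\<^esub> nov_class A X t = nov_class A X (Minus s t)"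
    if "s \<in> nov_terms A X" "t \<in> nov_terms A X" for s t
    using that by (simp add: module_minus_eq[OF Nov_module])
  fix a x y and c :: 'k
  assume a: "a \<in> A" and "x \<in> carrier ?N" "y \<in> carrier ?N"
  then obtain s t where s: "s \<in> nov_terms A X" "t \<in> nov_terms A X"
    and x: "x = nov_class A X s" "y = nov_class A X t"
    by (blast elim: Nov_carrierE)
  note st = a s
  show "tri ?N a x y \<in> carrier ?N"
    using st by (simp add: x)
  show "tri ?N a (c \<odot>\<^bsub>?N\<^esub> x) y = c \<odot>\<^bsub>?N\<^esub> tri ?N a x y"
    using st nov_class_eqI[OF nov_eq.tri_scale_left, OF st] by (simp add: x)
  show "tri ?N a x (c \<odot>\<^bsub>?N\<^esub> y) = c \<odot>\<^bsub>?N\<^esub> tri ?N a x y"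
    using st nov_class_eqI[OF nov_eq.tri_scale_right, OF st] by (simp add: x)
  fix z assume "z \<in> carrier ?N"
  then obtain u where u: "u \<in> nov_terms A X" and z: "z = nov_class A X u"
    by (rule Nov_carrierE)
  show "tri ?N a (x \<oplus>\<^bsub>?N\<^esub> y) z = tri ?N a x z \<oplus>\<^bsub>?N\<^esub> tri ?N a y z"
    using st u nov_class_eqI[OF nov_eq.tri_plus_left, OF st u] by (simp add: x z)
  show "tri ?N a x (y \<oplus>\<^bsub>?N\<^esub> z) = tri ?N a x y \<oplus>\<^bsub>?N\<^esub> tri ?N a x z"
    using st u nov_class_eqI[OF nov_eq.tri_plus_right, OF st u] by (simp add: x z)
  fix b assume b: "b \<in> A"
  show "tri ?N b (tri ?N a x y) z \<ominus>\<^bsub>?N\<^esub> tri ?N a x (tri ?N b y z)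
      = tri ?N b (tri ?N a y x) z \<ominus>\<^bsub>?N\<^esub> tri ?N a y (tri ?N b x z)"
    using st b u nov_class_eqI[OF nov_eq.nov1, OF a b s u] by (simp add: x z)
  show "tri ?N b (tri ?N a x y) z \<ominus>\<^bsub>?N\<^esub> tri ?N a x (tri ?N b y z)
      = tri ?N a (tri ?N b x y) z \<ominus>\<^bsub>?N\<^esub> tri ?N b x (tri ?N a y z)"
    using st b u nov_class_eqI[OF nov_eq.nov2, OF a b s u] by (simp add: x z)
  show "tri ?N b (tri ?N a x y) z = tri ?N a (tri ?N b x z) y"
    using st b u nov_class_eqI[OF nov_eq.nov3, OF a b s u] by (simp add: x z)
qed

primrec nov_eval :: "('k::field, 'v, 'a) multi_alg \<Rightarrow> ('x \<Rightarrow> 'v) \<Rightarrow> ('k, 'a, 'x) nov_term \<Rightarrow> 'v" where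
  "nov_eval V f (Gen x) = f x"
| "nov_eval V f Zero = \<zero>\<^bsub>V\<^esub>"
| "nov_eval V f (Plus s t) = nov_eval V f s \<oplus>\<^bsub>V\<^esub> nov_eval V f t"
| "nov_eval V f (Scale c s) = c \<odot>\<^bsub>V\<^esub> nov_eval V f s"
| "nov_eval V f (Tri a s t) = tri V a (nov_eval V f s) (nov_eval V f t)"

lemma (in multi_novikov) nov_eval_closed:
  assumes "f \<in> X \<rightarrow> carrier V" "t \<in> nov_terms A X"
  shows "nov_eval V f t \<in> carrier V"
  using assms(2,1) by induction (auto simp: tri_closed)

lemma (in multi_novikov) nov_eval_eq:
  assumes "f \<in> X \<rightarrow> carrier V" "nov_eq A X s t"
  shows "nov_eval V f s = nov_eval V f t"
  using assms(2)
proof induction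
  note [simp] = nov_eval_closed[OF assms(1)] tri_closed
  have m: "module field_ring V" by unfold_locales
  note minus = module_minus_eq[OF m, symmetric]
  {
    case (plus_minus s)
    then show ?case by (simp add: minus a_minus_def M.r_neg)
  next
    case (scale_plus_left s c d)
    then show ?case using smult_l_distr[of c d] by simp
  next
    case (scale_scale s c d)
    then show ?case using smult_assoc1[of c d] by simp
  next
    case (scale_one s)
    then show ?case using smult_one by simp
  next
    case (nov1 a b x y z)
    then show ?case by (simp add: minus novikov1)
  next
    case (nov2 a b x y z)
    then show ?case by (simp add: minus novikov2[of a b])
  next
    case (nov3 a b x y z)
    then show ?case by (simp add: novikov3[of a b])
  }
qed (auto simp: nov_eval_closed[OF assms(1)] tri_closed M.add.m_ac smult_r_distr
    tri_add_left tri_add_right tri_smult_left tri_smult_right)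

theorem Nov_universal:
  fixes A :: "'a set" and X :: "'x set" and V :: "('k::field, 'v, 'a) multi_alg"
  assumes V: "multi_novikov A V" and f: "f \<in> X \<rightarrow> carrier V"
  shows "\<exists>h\<in>mn_hom A (Nov A X) V. (\<forall>x\<in>X. h (nov_gen A X x) = f x) \<and>
    (\<forall>h'\<in>mn_hom A (Nov A X) V. (\<forall>x\<in>X. h' (nov_gen A X x) = f x) \<longrightarrow>
      (\<forall>C\<in>carrier (Nov A X). h' C = h C))"
proof -
  interpret multi_novikov A V by (rule V)
  define h where "h C = nov_eval V f (SOME t. t \<in> C)" for C :: "('k, 'a, 'x) nov_term set"
  have h: "h (nov_class A X t) = nov_eval V f t" if "t \<in> nov_terms A X" for t
  proof -
    have "(SOME s. s \<in> nov_class A X t) \<in> nov_class A X t"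
      by (rule someI) (rule mem_nov_class_self[OF that])
    then show ?thesis
      unfolding h_def using nov_eval_eq[OF f] mem_nov_classD by metis
  qed
  have hom: "h \<in> mn_hom A (Nov A X) V"
    unfolding mn_hom_def
    by (auto simp: Nov_carrier_iff h Nov_add Nov_smult Nov_tri nov_terms.intros
        nov_eval_closed[OF f])
  have uniq: "h' (nov_class A X t) = nov_eval V f t"
    if h': "h' \<in> mn_hom A (Nov A X) V" "\<forall>x\<in>X. h' (nov_gen A X x) = f x"
      and t: "t \<in> nov_terms A X" for h' t
    using t
  proof induction
    case (Gen x)
    then show ?case using h'(2) by (simp add: nov_gen_def)
  next
    case Zero
    interpret N: module field_ring "Nov A X :: ('k, _, 'a) multi_alg" by (rule Nov_module)
    have "h' (0 \<odot>\<^bsub>Nov A X\<^esub> \<zero>\<^bsub>Nov A X\<^esub>) = 0 \<odot>\<^bsub>V\<^esub> h' \<zero>\<^bsub>Nov A X\<^esub>"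
      using h'(1) N.zero_closed unfolding mn_hom_def by blast
    moreover have "h' \<zero>\<^bsub>Nov A X\<^esub> \<in> carrier V"
      using h'(1) N.zero_closed unfolding mn_hom_def by blast
    ultimately show ?case
      using N.smult_r_null[of 0] smult_l_null by (simp add: Nov_zero)
  next
    case (Plus s t)
    have "h' (nov_class A X s \<oplus>\<^bsub>Nov A X\<^esub> nov_class A X t)
        = h' (nov_class A X s) \<oplus>\<^bsub>V\<^esub> h' (nov_class A X t)"
      using h'(1) Plus.hyps[THEN nov_class_closed] unfolding mn_hom_def by blast
    with Plus show ?case by (simp add: Nov_add)
  next
    case (Scale s c)
    have "h' (c \<odot>\<^bsub>Nov A X\<^esub> nov_class A X s) = c \<odot>\<^bsub>V\<^esub> h' (nov_class A X s)"
      using h'(1) Scale.hyps[THEN nov_class_closed] unfolding mn_hom_def by blast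
    with Scale show ?case by (simp add: Nov_smult)
  next
    case (Tri a s t)
    have "h' (tri (Nov A X) a (nov_class A X s) (nov_class A X t))
        = tri V a (h' (nov_class A X s)) (h' (nov_class A X t))"
      using h'(1) Tri.hyps(1) Tri.hyps(2,3)[THEN nov_class_closed] unfolding mn_hom_def by blast
    with Tri show ?case by (simp add: Nov_tri)
  qed
  show ?thesis
  proof (rule bexI[OF _ hom], intro conjI ballI impI)
    show "h (nov_gen A X x) = f x" if "x \<in> X" for x
      using that by (simp add: nov_gen_def h nov_terms.Gen)
  qed (auto simp: Nov_carrier_iff h uniq)
qed


section \<open>Commutative multidifferential algebras\<close>

record ('k, 'v, 'a) multi_diff = "('k, 'v) module" +
  der :: "'a \<Rightarrow> 'v \<Rightarrow> 'v"

text \<open>No unit element is required: the record field \<open>one\<close> is not constrained.\<close>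

locale comm_multi_diff = module field_ring R
  for A :: "'a set" and R :: "('k::field, 'v, 'a) multi_diff" (structure) +
  assumes mult_closed:
      "\<lbrakk>x \<in> carrier R; y \<in> carrier R\<rbrakk> \<Longrightarrow> x \<otimes>\<^bsub>R\<^esub> y \<in> carrier R"
    and mult_assoc: "\<lbrakk>x \<in> carrier R; y \<in> carrier R; z \<in> carrier R\<rbrakk>
      \<Longrightarrow> (x \<otimes>\<^bsub>R\<^esub> y) \<otimes>\<^bsub>R\<^esub> z = x \<otimes>\<^bsub>R\<^esub> (y \<otimes>\<^bsub>R\<^esub> z)"
    and mult_comm: "\<lbrakk>x \<in> carrier R; y \<in> carrier R\<rbrakk> \<Longrightarrow> x \<otimes>\<^bsub>R\<^esub> y = y \<otimes>\<^bsub>R\<^esub> x"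
    and mult_add: "\<lbrakk>x \<in> carrier R; y \<in> carrier R; z \<in> carrier R\<rbrakk>
      \<Longrightarrow> (x \<oplus>\<^bsub>R\<^esub> y) \<otimes>\<^bsub>R\<^esub> z = x \<otimes>\<^bsub>R\<^esub> z \<oplus>\<^bsub>R\<^esub> y \<otimes>\<^bsub>R\<^esub> z"
    and mult_smult: "\<lbrakk>x \<in> carrier R; y \<in> carrier R\<rbrakk>
      \<Longrightarrow> (c \<odot>\<^bsub>R\<^esub> x) \<otimes>\<^bsub>R\<^esub> y = c \<odot>\<^bsub>R\<^esub> (x \<otimes>\<^bsub>R\<^esub> y)"
    and der_closed: "\<lbrakk>a \<in> A; x \<in> carrier R\<rbrakk> \<Longrightarrow> der R a x \<in> carrier R"
    and der_add: "\<lbrakk>a \<in> A; x \<in> carrier R; y \<in> carrier R\<rbrakk>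
      \<Longrightarrow> der R a (x \<oplus>\<^bsub>R\<^esub> y) = der R a x \<oplus>\<^bsub>R\<^esub> der R a y"
    and der_smult: "\<lbrakk>a \<in> A; x \<in> carrier R\<rbrakk> \<Longrightarrow> der R a (c \<odot>\<^bsub>R\<^esub> x) = c \<odot>\<^bsub>R\<^esub> der R a x"
    and der_mult: "\<lbrakk>a \<in> A; x \<in> carrier R; y \<in> carrier R\<rbrakk>
      \<Longrightarrow> der R a (x \<otimes>\<^bsub>R\<^esub> y) = der R a x \<otimes>\<^bsub>R\<^esub> y \<oplus>\<^bsub>R\<^esub> x \<otimes>\<^bsub>R\<^esub> der R a y"
    and der_comm: "\<lbrakk>a \<in> A; b \<in> A; x \<in> carrier R\<rbrakk>
      \<Longrightarrow> der R a (der R b x) = der R b (der R a x)"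

definition canonical_novikov :: "('k, 'v, 'a) multi_diff \<Rightarrow> ('k, 'v, 'a) multi_alg" where
  "canonical_novikov R = \<lparr>carrier = carrier R, mult = mult R, one = one R, zero = zero R,
     add = add R, smult = smult R, tri = (\<lambda>a x y. x \<otimes>\<^bsub>R\<^esub> der R a y)\<rparr>"

text \<open>Polynomials over \<open>'k\<close> in variables from \<open>'x \<times> ('a \<Rightarrow>\<^sub>0 nat)\<close>: a monomial is a
  finitely supported family of exponents, and a polynomial is a finitely supported family
  of coefficients indexed by monomials.\<close>

type_synonym ('a, 'x) cd_index = "'x \<times> ('a \<Rightarrow>\<^sub>0 nat)"
type_synonym ('a, 'x) cd_monom = "('a, 'x) cd_index \<Rightarrow>\<^sub>0 nat"
type_synonym ('k, 'a, 'x) cd_poly = "('a, 'x) cd_monom \<Rightarrow>\<^sub>0 'k"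

definition cd_indices :: "'a set \<Rightarrow> 'x set \<Rightarrow> ('a, 'x) cd_index set" where
  "cd_indices A X = X \<times> {m. Poly_Mapping.keys m \<subseteq> A}"

definition cd_carrier :: "'a set \<Rightarrow> 'x set \<Rightarrow> ('k::field, 'a, 'x) cd_poly set" where
  "cd_carrier A X = {p. \<forall>w\<in>Poly_Mapping.keys p. Poly_Mapping.keys w \<subseteq> cd_indices A X}"

definition cd_ivar :: "('a, 'x) cd_index \<Rightarrow> ('k::field, 'a, 'x) cd_poly" where
  "cd_ivar v = Poly_Mapping.single (Poly_Mapping.single v 1) 1"

definition cd_var :: "'x \<Rightarrow> ('k::field, 'a, 'x) cd_poly" where
  "cd_var x = cd_ivar (x, 0)"

fun cd_shift :: "'a \<Rightarrow> ('a, 'x) cd_index \<Rightarrow> ('a, 'x) cd_index" where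
  "cd_shift a (x, m) = (x, m + Poly_Mapping.single a 1)"

text \<open>The chain rule: \<open>\<partial>\<^sub>a p\<close> is the sum over the variables \<open>v\<close> of the partial derivative of
  \<open>p\<close> with respect to \<open>v\<close>, times the variable \<open>cd_shift a v\<close>. That this is the unique
  derivation with \<open>\<partial>\<^sub>a v = cd_shift a v\<close> is shown below.\<close>

definition cd_der :: "'a \<Rightarrow> ('k::field, 'a, 'x) cd_poly \<Rightarrow> ('k, 'a, 'x) cd_poly" where
  "cd_der a p = (\<Sum>w\<in>Poly_Mapping.keys p. \<Sum>v\<in>Poly_Mapping.keys w.
     Poly_Mapping.single (w - Poly_Mapping.single v 1 + Poly_Mapping.single (cd_shift a v) 1)
       (Poly_Mapping.lookup p w * of_nat (Poly_Mapping.lookup w v)))"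

definition CD :: "'a set \<Rightarrow> 'x set \<Rightarrow> ('k::field, ('k, 'a, 'x) cd_poly, 'a) multi_diff" where
  "CD A X = \<lparr>carrier = cd_carrier A X, mult = (*), one = 1, zero = 0, add = (+),
     smult = (\<lambda>c p. Poly_Mapping.single 0 c * p), der = cd_der\<rparr>"

theorem (in comm_multi_diff) canonical_multi_novikov:
  "multi_novikov A (canonical_novikov R)"
proof -
  let ?N = "canonical_novikov R"
  note S = canonical_novikov_def
  have m: "module field_ring ?N"
  proof (rule moduleI)
    show "cring field_ring" by (rule cring_field_ring)
    show "abelian_group ?N"
    proof (rule abelian_groupI)
      show "\<exists>y\<in>carrier ?N. y \<oplus>\<^bsub>?N\<^esub> x = \<zero>\<^bsub>?N\<^esub>" if "x \<in> carrier ?N" for x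
        using that M.l_neg[of x] by (auto simp: S intro: bexI[of _ "\<ominus>\<^bsub>R\<^esub> x"])
    qed (simp_all add: S M.add.m_ac)
  qed (use smult_l_distr smult_r_distr smult_assoc1 smult_one in \<open>auto simp: S\<close>)
  interpret N: module field_ring ?N by (rule m)
  have mr: "module field_ring R" by unfold_locales
  have minus: "x \<ominus>\<^bsub>?N\<^esub> y = x \<ominus>\<^bsub>R\<^esub> y" if "x \<in> carrier R" "y \<in> carrier R" for x y
    using module_minus_eq[OF m, of x y] module_minus_eq[OF mr, of x y] that by (simp add: S)
  have add_mult: "x \<otimes>\<^bsub>R\<^esub> (y \<oplus>\<^bsub>R\<^esub> z) = x \<otimes>\<^bsub>R\<^esub> y \<oplus>\<^bsub>R\<^esub> x \<otimes>\<^bsub>R\<^esub> z"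
    if "x \<in> carrier R" "y \<in> carrier R" "z \<in> carrier R" for x y z
    using that mult_comm mult_add mult_closed by (metis M.add.m_closed)
  have smult_mult: "x \<otimes>\<^bsub>R\<^esub> (c \<odot>\<^bsub>R\<^esub> y) = c \<odot>\<^bsub>R\<^esub> (x \<otimes>\<^bsub>R\<^esub> y)"
    if "x \<in> carrier R" "y \<in> carrier R" for c x y
    using that mult_comm mult_smult smult_closed[of c] by (metis UNIV_I field_ring_simps(1))
  have lcomm: "x \<otimes>\<^bsub>R\<^esub> (y \<otimes>\<^bsub>R\<^esub> z) = y \<otimes>\<^bsub>R\<^esub> (x \<otimes>\<^bsub>R\<^esub> z)"
    if "x \<in> carrier R" "y \<in> carrier R" "z \<in> carrier R" for x y z
    using that mult_comm mult_assoc by metis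
  have assoc: "tri ?N b (tri ?N a x y) z \<ominus>\<^bsub>?N\<^esub> tri ?N a x (tri ?N b y z)
      = \<ominus>\<^bsub>R\<^esub> (x \<otimes>\<^bsub>R\<^esub> (y \<otimes>\<^bsub>R\<^esub> der R a (der R b z)))"
    if "a \<in> A" "b \<in> A" "x \<in> carrier R" "y \<in> carrier R" "z \<in> carrier R" for a b x y z
  proof -
    let ?u = "x \<otimes>\<^bsub>R\<^esub> (der R a y \<otimes>\<^bsub>R\<^esub> der R b z)"
    let ?w = "x \<otimes>\<^bsub>R\<^esub> (y \<otimes>\<^bsub>R\<^esub> der R a (der R b z))"
    have uw: "?u \<in> carrier R" "?w \<in> carrier R"
      using that by (auto intro: mult_closed der_closed)
    have "tri ?N b (tri ?N a x y) z \<ominus>\<^bsub>?N\<^esub> tri ?N a x (tri ?N b y z) = ?u \<ominus>\<^bsub>R\<^esub> (?u \<oplus>\<^bsub>R\<^esub> ?w)"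
      using that by (subst minus)
        (auto simp: S mult_closed der_closed der_mult mult_assoc add_mult)
    also have "\<dots> = \<ominus>\<^bsub>R\<^esub> ?w"
      using uw by (simp add: a_minus_def M.minus_add M.a_assoc[symmetric] M.r_neg)
    finally show ?thesis .
  qed
  show ?thesis
  proof unfold_locales
    fix a b x y z
    assume "a \<in> A" "b \<in> A" "x \<in> carrier ?N" "y \<in> carrier ?N" "z \<in> carrier ?N"
    then have *: "a \<in> A" "b \<in> A" "x \<in> carrier R" "y \<in> carrier R" "z \<in> carrier R"
      by (auto simp: S)
    show "tri ?N b (tri ?N a x y) z \<ominus>\<^bsub>?N\<^esub> tri ?N a x (tri ?N b y z)
        = tri ?N b (tri ?N a y x) z \<ominus>\<^bsub>?N\<^esub> tri ?N a y (tri ?N b x z)"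
      using * by (simp add: assoc lcomm[of x y] der_closed)
    show "tri ?N b (tri ?N a x y) z \<ominus>\<^bsub>?N\<^esub> tri ?N a x (tri ?N b y z)
        = tri ?N a (tri ?N b x y) z \<ominus>\<^bsub>?N\<^esub> tri ?N b x (tri ?N a y z)"
      using * by (simp add: assoc der_comm[of a b z])
    show "tri ?N b (tri ?N a x y) z = tri ?N a (tri ?N b x z) y"
      using * by (simp add: S mult_assoc der_closed mult_comm[of "der R a y"])
  qed (auto simp: S mult_closed der_closed mult_add mult_smult der_add der_smult
      add_mult smult_mult)
qed

definition cd_mder :: "'a \<Rightarrow> ('a, 'x) cd_monom \<Rightarrow> ('k::field, 'a, 'x) cd_poly" where
  "cd_mder a w = (\<Sum>v\<in>Poly_Mapping.keys w.
     Poly_Mapping.single (w - Poly_Mapping.single v 1 + Poly_Mapping.single (cd_shift a v) 1)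
       (of_nat (Poly_Mapping.lookup w v)))"

lemma cd_mder_superset:
  assumes "finite S" "Poly_Mapping.keys w \<subseteq> S"
  shows "cd_mder a w = (\<Sum>v\<in>S.
     Poly_Mapping.single (w - Poly_Mapping.single v 1 + Poly_Mapping.single (cd_shift a v) 1)
       (of_nat (Poly_Mapping.lookup w v)))"
  unfolding cd_mder_def
  by (rule sum.mono_neutral_left) (use assms in \<open>auto simp: in_keys_iff\<close>)

lemma cd_mder_add:
  "(cd_mder a (w + u) :: ('k::field, 'a, 'x) cd_poly)
    = Poly_Mapping.single u 1 * cd_mder a w + Poly_Mapping.single w 1 * cd_mder a u"
proof -
  let ?S = "Poly_Mapping.keys w \<union> Poly_Mapping.keys u"
  let ?e = "\<lambda>v. Poly_Mapping.single v (1::nat)"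
  let ?d = "\<lambda>v. Poly_Mapping.single (cd_shift a v) (1::nat)"
  have half: "Poly_Mapping.single (w + u - ?e v + ?d v) (of_nat (Poly_Mapping.lookup w v))
      = Poly_Mapping.single u 1 *
        Poly_Mapping.single (w - ?e v + ?d v) (of_nat (Poly_Mapping.lookup w v) :: 'k)" for w u v
  proof (cases "Poly_Mapping.lookup w v = 0")
    case False
    then have "w + u - ?e v = u + (w - ?e v)"
      by (intro poly_mapping_eqI) (auto simp: lookup_add lookup_minus lookup_single when_def)
    then show ?thesis by (simp add: mult_single add.assoc)
  qed simp
  have "cd_mder a (w + u) = (\<Sum>v\<in>?S. Poly_Mapping.single (w + u - ?e v + ?d v)
      (of_nat (Poly_Mapping.lookup (w + u) v) :: 'k))"
    by (rule cd_mder_superset) (use Poly_Mapping.keys_add[of w u] in auto)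
  also have "\<dots> = (\<Sum>v\<in>?S.
      Poly_Mapping.single u 1 *
        Poly_Mapping.single (w - ?e v + ?d v) (of_nat (Poly_Mapping.lookup w v)) +
      Poly_Mapping.single w 1 *
        Poly_Mapping.single (u - ?e v + ?d v) (of_nat (Poly_Mapping.lookup u v)))"
  proof (rule sum.cong)
    fix v
    have "Poly_Mapping.single (w + u - ?e v + ?d v) (of_nat (Poly_Mapping.lookup (w + u) v) :: 'k)
      = Poly_Mapping.single (w + u - ?e v + ?d v) (of_nat (Poly_Mapping.lookup w v)) +
        Poly_Mapping.single (u + w - ?e v + ?d v) (of_nat (Poly_Mapping.lookup u v))"
      by (simp add: lookup_add single_add add.commute[of u w])
    then show "Poly_Mapping.single (w + u - ?e v + ?d v)
        (of_nat (Poly_Mapping.lookup (w + u) v) :: 'k) =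
      Poly_Mapping.single u 1 *
        Poly_Mapping.single (w - ?e v + ?d v) (of_nat (Poly_Mapping.lookup w v)) +
      Poly_Mapping.single w 1 *
        Poly_Mapping.single (u - ?e v + ?d v) (of_nat (Poly_Mapping.lookup u v))"
      by (simp only: half)
  qed simp
  also have "\<dots> = Poly_Mapping.single u 1 * cd_mder a w + Poly_Mapping.single w 1 * cd_mder a u"
    by (simp add: cd_mder_superset[of ?S w] cd_mder_superset[of ?S u] sum.distrib
        sum_distrib_left)
  finally show ?thesis .
qed

lemma cd_der_superset:
  assumes "finite S" "Poly_Mapping.keys p \<subseteq> S"
  shows "cd_der a p
    = (\<Sum>w\<in>S. Poly_Mapping.single 0 (Poly_Mapping.lookup p w) * cd_mder a w)"
proof -
  have "cd_der a p
      = (\<Sum>w\<in>Poly_Mapping.keys p. Poly_Mapping.single 0 (Poly_Mapping.lookup p w) * cd_mder a w)"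
    unfolding cd_der_def cd_mder_def by (simp add: sum_distrib_left mult_single)
  also have "\<dots> = (\<Sum>w\<in>S. Poly_Mapping.single 0 (Poly_Mapping.lookup p w) * cd_mder a w)"
    by (rule sum.mono_neutral_left) (use assms in \<open>auto simp: in_keys_iff\<close>)
  finally show ?thesis .
qed

lemma cd_der_single: "cd_der a (Poly_Mapping.single w c) = Poly_Mapping.single 0 c * cd_mder a w"
  by (subst cd_der_superset[of "{w}"]) (auto split: if_splits)

lemma cd_der_add: "cd_der a (p + q) = cd_der a p + cd_der a q"
proof -
  let ?S = "Poly_Mapping.keys p \<union> Poly_Mapping.keys q"
  have "Poly_Mapping.keys (p + q) \<subseteq> ?S" by (rule Poly_Mapping.keys_add)
  then show ?thesis
    by (simp add: cd_der_superset[of ?S] lookup_add single_add distrib_right sum.distrib)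
qed

lemma cd_der_zero: "cd_der a 0 = 0"
  by (simp add: cd_der_def)

lemma cd_poly_induct [case_names zero single add]:
  assumes "P 0" "\<And>w c. P (Poly_Mapping.single w c)" "\<And>p q. P p \<Longrightarrow> P q \<Longrightarrow> P (p + q)"
  shows "P (p :: 'b \<Rightarrow>\<^sub>0 'k::comm_monoid_add)"
proof (induction p rule: update_induct)
  case const
  show ?case by (rule assms(1))
next
  case (update p w c)
  then have "Poly_Mapping.update w c p = p + Poly_Mapping.single w c"
    by (intro poly_mapping_eqI)
      (auto simp: lookup_update lookup_add lookup_single when_def in_keys_iff)
  with update assms(2,3) show ?case by simp
qed

lemma cd_der_mult: "cd_der a (p * q) = cd_der a p * q + p * cd_der a q"
proof (induction p rule: cd_poly_induct)
  case (single w c)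
  show ?case
  proof (induction q rule: cd_poly_induct)
    case (single u d)
    have "cd_der a (Poly_Mapping.single w c * Poly_Mapping.single u d)
        = Poly_Mapping.single 0 c * Poly_Mapping.single 0 d *
          (Poly_Mapping.single u 1 * cd_mder a w + Poly_Mapping.single w 1 * cd_mder a u)"
      by (simp add: mult_single cd_der_single cd_mder_add)
    moreover have "cd_der a (Poly_Mapping.single w c) * Poly_Mapping.single u d +
          Poly_Mapping.single w c * cd_der a (Poly_Mapping.single u d)
        = Poly_Mapping.single 0 c * cd_mder a w *
            (Poly_Mapping.single 0 d * Poly_Mapping.single u 1) +
          (Poly_Mapping.single 0 c * Poly_Mapping.single w 1) *
            (Poly_Mapping.single 0 d * cd_mder a u)"
      by (simp add: mult_single cd_der_single)
    ultimately show ?case by (simp only: algebra_simps)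
  qed (simp_all add: cd_der_zero cd_der_add distrib_left add.assoc add.commute add.left_commute)
qed (simp_all add: cd_der_zero cd_der_add distrib_right add.assoc add.commute add.left_commute)

lemma cd_der_const: "cd_der a (Poly_Mapping.single 0 c) = 0"
  by (simp add: cd_der_single cd_mder_def)

lemma cd_der_smult:
  "cd_der a (Poly_Mapping.single 0 c * p) = Poly_Mapping.single 0 c * cd_der a p"
  by (simp add: cd_der_mult cd_der_const)

lemma cd_der_ivar: "cd_der a (cd_ivar v) = cd_ivar (cd_shift a v)"
  by (simp add: cd_ivar_def cd_der_single cd_mder_def)

lemma cd_carrier_closed:
  "0 \<in> cd_carrier A X"
  "p \<in> cd_carrier A X \<Longrightarrow> q \<in> cd_carrier A X \<Longrightarrow> p + q \<in> cd_carrier A X"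
  "p \<in> cd_carrier A X \<Longrightarrow> q \<in> cd_carrier A X \<Longrightarrow> p * q \<in> cd_carrier A X"
  "Poly_Mapping.single 0 c \<in> cd_carrier A X"
  "v \<in> cd_indices A X \<Longrightarrow> cd_ivar v \<in> cd_carrier A X"
proof -
  show "p + q \<in> cd_carrier A X" if "p \<in> cd_carrier A X" "q \<in> cd_carrier A X"
    using that Poly_Mapping.keys_add[of p q] by (auto simp: cd_carrier_def)
  show "p * q \<in> cd_carrier A X" if pq: "p \<in> cd_carrier A X" "q \<in> cd_carrier A X"
    unfolding cd_carrier_def
  proof (intro CollectI ballI)
    fix w assume "w \<in> Poly_Mapping.keys (p * q)"
    then obtain u v where "w = u + v" "u \<in> Poly_Mapping.keys p" "v \<in> Poly_Mapping.keys q"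
      using Poly_Mapping.keys_mult[of p q] by blast
    with pq Poly_Mapping.keys_add[of u v] show "Poly_Mapping.keys w \<subseteq> cd_indices A X"
      unfolding cd_carrier_def by blast
  qed
qed (auto simp: cd_carrier_def cd_ivar_def)

lemma cd_carrier_sum:
  "(\<And>i. i \<in> I \<Longrightarrow> p i \<in> cd_carrier A X) \<Longrightarrow> sum p I \<in> cd_carrier A X"
  by (induction I rule: infinite_finite_induct) (auto intro: cd_carrier_closed)

lemma cd_der_closed:
  assumes "a \<in> A" "p \<in> cd_carrier A X"
  shows "cd_der a p \<in> cd_carrier A X"
  unfolding cd_der_def
proof (intro cd_carrier_sum)
  fix w v assume w: "w \<in> Poly_Mapping.keys p" and v: "v \<in> Poly_Mapping.keys w"
  let ?w = "w - Poly_Mapping.single v 1"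
  have kw: "Poly_Mapping.keys w \<subseteq> cd_indices A X"
    using w assms(2) by (auto simp: cd_carrier_def)
  have "Poly_Mapping.keys ?w \<subseteq> Poly_Mapping.keys w"
    by (auto simp: in_keys_iff lookup_minus)
  moreover have "cd_shift a v \<in> cd_indices A X"
  proof (cases v)
    case (Pair x m)
    with v kw have "x \<in> X" "Poly_Mapping.keys m \<subseteq> A" by (auto simp: cd_indices_def)
    with Pair assms(1) Poly_Mapping.keys_add[of m "Poly_Mapping.single a 1"]
    show ?thesis by (auto simp: cd_indices_def)
  qed
  ultimately have
    "Poly_Mapping.keys (?w + Poly_Mapping.single (cd_shift a v) 1) \<subseteq> cd_indices A X"
    using kw Poly_Mapping.keys_add[of ?w "Poly_Mapping.single (cd_shift a v) 1"]
    unfolding keys_single by (simp split: if_splits) blast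
  then show "Poly_Mapping.single (?w + Poly_Mapping.single (cd_shift a v) 1)
      (Poly_Mapping.lookup p w * of_nat (Poly_Mapping.lookup w v)) \<in> cd_carrier A X"
    by (auto simp: cd_carrier_def)
qed

lemma cd_derivation_unique:
  fixes D E :: "('k::field, 'a, 'x) cd_poly \<Rightarrow> ('k, 'a, 'x) cd_poly"
  assumes add: "\<And>p q. p \<in> cd_carrier A X \<Longrightarrow> q \<in> cd_carrier A X \<Longrightarrow> D (p + q) = D p + D q"
      "\<And>p q. p \<in> cd_carrier A X \<Longrightarrow> q \<in> cd_carrier A X \<Longrightarrow> E (p + q) = E p + E q"
    and smult: "\<And>c p. p \<in> cd_carrier A X
        \<Longrightarrow> D (Poly_Mapping.single 0 c * p) = Poly_Mapping.single 0 c * D p"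
      "\<And>c p. p \<in> cd_carrier A X
        \<Longrightarrow> E (Poly_Mapping.single 0 c * p) = Poly_Mapping.single 0 c * E p"
    and mult: "\<And>p q. p \<in> cd_carrier A X \<Longrightarrow> q \<in> cd_carrier A X \<Longrightarrow> D (p * q) = D p * q + p * D q"
      "\<And>p q. p \<in> cd_carrier A X \<Longrightarrow> q \<in> cd_carrier A X \<Longrightarrow> E (p * q) = E p * q + p * E q"
    and eq: "\<And>v. v \<in> cd_indices A X \<Longrightarrow> D (cd_ivar v) = E (cd_ivar v)"
    and p: "p \<in> cd_carrier A X"
  shows "D p = E p"
proof -
  note cl = cd_carrier_closed[where A = A and X = X]
  have one_in: "(1 :: ('k, 'a, 'x) cd_poly) \<in> cd_carrier A X"
    using cl(4)[of 1] by simp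
  have D1: "D 1 = 0" and E1: "E 1 = 0"
    using mult(1)[OF one_in one_in] mult(2)[OF one_in one_in] by simp_all
  have D0: "D 0 = 0" and E0: "E 0 = 0"
    using smult(1)[OF one_in, of 0] smult(2)[OF one_in, of 0] by simp_all
  have var_in: "Poly_Mapping.single (Poly_Mapping.single v n) (1::'k) \<in> cd_carrier A X"
    if "v \<in> cd_indices A X" for v n
    using that by (auto simp: cd_carrier_def)
  have pow: "D (Poly_Mapping.single (Poly_Mapping.single v n) 1)
      = E (Poly_Mapping.single (Poly_Mapping.single v n) 1)" if v: "v \<in> cd_indices A X" for v n
  proof (induction n)
    case 0
    then show ?case by (simp add: D1 E1)
  next
    case (Suc n)
    have "Poly_Mapping.single (Poly_Mapping.single v (Suc n)) (1::'k)
        = cd_ivar v * Poly_Mapping.single (Poly_Mapping.single v n) 1"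
      by (simp add: cd_ivar_def mult_single flip: single_add)
    then show ?case
      using Suc mult[OF cl(5)[OF v] var_in[OF v]] eq[OF v] by simp
  qed
  have mon: "Poly_Mapping.keys w \<subseteq> cd_indices A X \<Longrightarrow>
    D (Poly_Mapping.single w 1) = E (Poly_Mapping.single w 1)" for w
  proof (induction w rule: update_induct)
    case const
    then show ?case by (simp add: D1 E1)
  next
    case (update w v n)
    have u: "Poly_Mapping.update v n w = Poly_Mapping.single v n + w"
      using update.hyps by (intro poly_mapping_eqI)
        (auto simp: lookup_update lookup_add lookup_single when_def in_keys_iff)
    have v: "v \<in> cd_indices A X" and w: "Poly_Mapping.keys w \<subseteq> cd_indices A X"
      using update by (auto simp: keys_update split: if_splits)
    have "Poly_Mapping.single (Poly_Mapping.update v n w) (1::'k)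
        = Poly_Mapping.single (Poly_Mapping.single v n) 1 * Poly_Mapping.single w 1"
      by (simp add: u mult_single)
    moreover have "Poly_Mapping.single w (1::'k) \<in> cd_carrier A X"
      using w by (auto simp: cd_carrier_def)
    ultimately show ?case
      using mult[OF var_in[OF v]] pow[OF v] update.IH[OF w] by simp
  qed
  show ?thesis
    using p
  proof (induction p rule: update_induct)
    case const
    then show ?case by (simp add: D0 E0)
  next
    case (update p w c)
    have u: "Poly_Mapping.update w c p
        = Poly_Mapping.single 0 c * Poly_Mapping.single w 1 + p"
      using update.hyps by (intro poly_mapping_eqI)
        (auto simp: mult_single lookup_update lookup_add lookup_single when_def in_keys_iff)
    have pc: "p \<in> cd_carrier A X" and w: "Poly_Mapping.keys w \<subseteq> cd_indices A X"
      using update by (auto simp: cd_carrier_def keys_update split: if_splits)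
    have wc: "Poly_Mapping.single w (1::'k) \<in> cd_carrier A X"
      using w by (auto simp: cd_carrier_def)
    show ?case
      unfolding u using add[OF cl(3)[OF cl(4) wc] pc] smult[OF wc] mon[OF w] update.IH[OF pc]
      by simp
  qed
qed

lemma cd_shift_comm: "cd_shift a (cd_shift b v) = cd_shift b (cd_shift a v)"
  by (cases v) (simp add: ac_simps)

lemma cd_der_comm: "cd_der a (cd_der b p) = cd_der b (cd_der a p)"
proof -
  let ?C = "\<lambda>p. cd_der a (cd_der b p) - cd_der b (cd_der a p)"
  have "?C p = 0"
    by (rule cd_derivation_unique[where A = UNIV and X = UNIV and D = ?C and E = "\<lambda>_. 0"])
      (simp_all add: cd_der_add cd_der_smult cd_der_mult cd_der_ivar cd_shift_comm[of a b]
        cd_der_const cd_carrier_def cd_indices_def algebra_simps)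
  then show ?thesis by simp
qed

theorem CD_comm_multi_diff:
  fixes A :: "'a set" and X :: "'x set"
  shows "comm_multi_diff A (CD A X :: ('k::field, _, _) multi_diff)" (is "comm_multi_diff _ ?R")
proof -
  note S = CD_def
  note cl = cd_carrier_closed cd_der_closed
  have m: "module field_ring ?R"
  proof (rule moduleI)
    show "cring (field_ring :: 'k ring)"
      by (rule cring_field_ring)
    show "abelian_group ?R"
    proof (rule abelian_groupI)
      show "\<exists>y\<in>carrier ?R. y \<oplus>\<^bsub>?R\<^esub> x = \<zero>\<^bsub>?R\<^esub>" if "x \<in> carrier ?R" for x
        using that by (intro bexI[of _ "- x"]) (auto simp: S cd_carrier_def in_keys_iff)
    qed (auto simp: S cl ac_simps)
  qed (auto simp: S cl distrib_left distrib_right single_add mult_single mult.assoc[symmetric])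
  show ?thesis
    by (rule comm_multi_diff.intro[OF m], rule comm_multi_diff_axioms.intro)
      (auto simp: S cl distrib_right mult.assoc cd_der_add cd_der_mult cd_der_const
        intro: mult.commute cd_der_comm)
qed

end

theory Submission
  imports "HOL.Modules" "HOL-Library.Multiset" Defs
begin

text \<open>
  The homomorphism from the free algebra \<open>N\<close> that fixes \<open>X\<close> is onto the generated subalgebra;
  for injectivity we construct a left inverse. Give \<open>\<partial>\<^sub>a\<close> weight \<open>1\<close> and every generator
  weight \<open>-1\<close>, so that the image lies in weight \<open>-1\<close>. By the third identity the right
  multiplications \<open>z \<mapsto> z \<triangleright>\<^sub>a x\<close>, which stand for multiplication by \<open>\<partial>\<^sub>a x\<close>, commute;
  they generate a commutative algebra \<open>C\<close> of operators on \<open>N\<close>, in the role of weight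
  \<open>0\<close>. The first two identities say that left multiplication \<open>y \<triangleright>\<^sub>a _\<close>, which stands for
  \<open>y \<partial>\<^sub>a\<close>, acts on \<open>C\<close> by commutators, with the expected symmetries. An element of weight
  \<open>n - 1\<close> is then modelled by the symmetric \<open>n\<close>-linear map over \<open>C\<close> that multiplies it by
  \<open>n\<close> elements of \<open>N\<close>. On such maps there are commuting derivations \<open>\<partial>\<^sub>a\<close> and, for \<open>n \<ge> 1\<close>,
  a commutative product with the Leibniz rule. Hence every monomial of weight \<open>-1\<close> has a
  value in \<open>N\<close>: the product of its factors of weight at least \<open>0\<close> is applied to its factors
  of weight \<open>-1\<close>. No division occurs, so the characteristic is arbitrary.
\<close>

section \<open>The free multi-Novikov algebra as a type\<close>

lemma nov_terms_UNIV: "t \<in> nov_terms UNIV UNIV"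
  by (induction t) (auto intro: nov_terms.intros)

quotient_type (overloaded) ('k, 'a, 'x) nov = "('k::field, 'a, 'x) nov_term" / "nov_eq UNIV UNIV"
proof (rule equivpI)
  show "reflp (nov_eq UNIV UNIV :: ('k, 'a, 'x) nov_term \<Rightarrow> _)"
    by (rule reflpI) (rule nov_eq.refl[OF nov_terms_UNIV])
  show "symp (nov_eq UNIV UNIV :: ('k, 'a, 'x) nov_term \<Rightarrow> _)"
    by (rule sympI) (rule nov_eq.sym)
  show "transp (nov_eq UNIV UNIV :: ('k, 'a, 'x) nov_term \<Rightarrow> _)"
    by (rule transpI) (rule nov_eq.trans)
qed

instantiation nov :: (field, type, type) ab_group_add
begin

lift_definition zero_nov :: "('a, 'b, 'c) nov" is Zero .
lift_definition plus_nov :: "('a, 'b, 'c) nov \<Rightarrow> ('a, 'b, 'c) nov \<Rightarrow> ('a, 'b, 'c) nov" is Plus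
  by (rule nov_eq.cong_Plus)
lift_definition uminus_nov :: "('a, 'b, 'c) nov \<Rightarrow> ('a, 'b, 'c) nov" is "Scale (- 1)"
  by (rule nov_eq.cong_Scale)
lift_definition minus_nov :: "('a, 'b, 'c) nov \<Rightarrow> ('a, 'b, 'c) nov \<Rightarrow> ('a, 'b, 'c) nov" is Minus
  by (intro nov_eq.cong_Plus nov_eq.cong_Scale)

instance
proof
  fix x y z :: "('a, 'b, 'c) nov"
  show "x + y + z = x + (y + z)"
    by transfer (intro nov_eq.plus_assoc nov_terms_UNIV)
  show comm: "x + y = y + x" for x y :: "('a, 'b, 'c) nov"
    by transfer (intro nov_eq.plus_comm nov_terms_UNIV)
  show "0 + x = x"
    by transfer (intro nov_eq.plus_zero nov_terms_UNIV)
  have "x + - x = 0"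
    by transfer (intro nov_eq.plus_minus nov_terms_UNIV)
  then show "- x + x = 0"
    by (simp add: comm)
  show "x - y = x + - y"
    by transfer (rule nov_eq.refl[OF nov_terms_UNIV])
qed

end

lift_definition scl :: "'k \<Rightarrow> ('k::field, 'a, 'x) nov \<Rightarrow> ('k, 'a, 'x) nov" is Scale
  by (rule nov_eq.cong_Scale)
lift_definition tr :: "'a \<Rightarrow> ('k::field, 'a, 'x) nov \<Rightarrow> ('k, 'a, 'x) nov \<Rightarrow> ('k, 'a, 'x) nov" is Tri
  by (intro nov_eq.cong_Tri UNIV_I)

lemma scl_add: "scl c (x + y) = scl c x + scl c y"
  by transfer (intro nov_eq.scale_plus_right nov_terms_UNIV)

lemma scl_add_left: "scl (c + d) x = scl c x + scl d x"
  by transfer (intro nov_eq.scale_plus_left nov_terms_UNIV)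

lemma scl_mult: "scl (c * d) x = scl c (scl d x)"
  by transfer (intro nov_eq.scale_scale nov_terms_UNIV)

lemma scl_left_commute: "scl c (scl d x) = scl d (scl c x)"
  by (simp add: scl_mult[symmetric] mult.commute)

lemma scl_one: "scl 1 x = x"
  by transfer (intro nov_eq.scale_one nov_terms_UNIV)

lemma scl_zero [simp]: "scl c 0 = 0"
  using scl_add[of c 0 0] by simp

lemma scl_zero_left [simp]: "scl 0 x = 0"
  using scl_add_left[of 0 0 x] by simp

lemma scl_sum: "scl c (sum f S) = (\<Sum>i\<in>S. scl c (f i))"
  by (induction S rule: infinite_finite_induct) (simp_all add: scl_add)

lemma tr_add_left: "tr a (x + y) z = tr a x z + tr a y z"
  by transfer (intro nov_eq.tri_plus_left nov_terms_UNIV UNIV_I)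

lemma tr_add_right: "tr a x (y + z) = tr a x y + tr a x z"
  by transfer (intro nov_eq.tri_plus_right nov_terms_UNIV UNIV_I)

lemma tr_scl_left: "tr a (scl c x) y = scl c (tr a x y)"
  by transfer (intro nov_eq.tri_scale_left nov_terms_UNIV UNIV_I)

lemma tr_scl_right: "tr a x (scl c y) = scl c (tr a x y)"
  by transfer (intro nov_eq.tri_scale_right nov_terms_UNIV UNIV_I)

lemma tr_assoc_swap_left:
  "tr b (tr a x y) z - tr a x (tr b y z) = tr b (tr a y x) z - tr a y (tr b x z)"
  by transfer (intro nov_eq.nov1 nov_terms_UNIV UNIV_I)

lemma tr_assoc_swap_index:
  "tr b (tr a x y) z - tr a x (tr b y z) = tr a (tr b x y) z - tr b x (tr a y z)"
  by transfer (intro nov_eq.nov2 nov_terms_UNIV UNIV_I)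

lemma tr_right_comm: "tr b (tr a x y) z = tr a (tr b x z) y"
  by transfer (intro nov_eq.nov3 nov_terms_UNIV UNIV_I)

lemma additive_tr: "additive (tr a x)" "additive (\<lambda>x. tr a x y)"
  by (simp_all add: additive_def tr_add_left tr_add_right)

lemmas tr_simps [simp] =
  additive.zero[OF additive_tr(1)] additive.zero[OF additive_tr(2)]
lemmas tr_diff =
  additive.diff[OF additive_tr(1)] additive.diff[OF additive_tr(2)]

lifting_forget nov.lifting


section \<open>The commutative algebra of right multiplications\<close>

inductive_set cen :: "(('k::field, 'a, 'x) nov \<Rightarrow> ('k, 'a, 'x) nov) set" where
  id: "(\<lambda>z. z) \<in> cen"
| zero: "(\<lambda>z. 0) \<in> cen"
| right: "(\<lambda>z. tr a z x) \<in> cen"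
| add: "c \<in> cen \<Longrightarrow> d \<in> cen \<Longrightarrow> (\<lambda>z. c z + d z) \<in> cen"
| diff: "c \<in> cen \<Longrightarrow> d \<in> cen \<Longrightarrow> (\<lambda>z. c z - d z) \<in> cen"
| comp: "c \<in> cen \<Longrightarrow> d \<in> cen \<Longrightarrow> (\<lambda>z. c (d z)) \<in> cen"

lemma cen_additive: "c \<in> cen \<Longrightarrow> additive c"
  by (induction rule: cen.induct) (auto simp: additive_def tr_add_left)

lemmas cen_plus = additive.add[OF cen_additive]
lemmas cen_minus = additive.diff[OF cen_additive]
lemmas cen_0 = additive.zero[OF cen_additive]

lemma cen_sum_mset:
  "(\<And>i. i \<in># I \<Longrightarrow> f i \<in> cen) \<Longrightarrow> (\<lambda>z. \<Sum>i\<in>#I. f i z) \<in> cen"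
  by (induction I) (simp_all add: cen.zero cen.add)

lemma sum_mset_eqI: "(\<And>i. i \<in># I \<Longrightarrow> f i = g i) \<Longrightarrow> (\<Sum>i\<in>#I. f i) = (\<Sum>i\<in>#I. g i)"
  by (rule arg_cong[of _ _ sum_mset], rule image_mset_cong)

lemma additive_sum_mset: "additive f \<Longrightarrow> f (\<Sum>i\<in>#I. g i) = (\<Sum>i\<in>#I. f (g i))"
  by (induction I) (auto simp: additive.zero additive.add)

lemma cen_tr: "c \<in> cen \<Longrightarrow> c (tr a z x) = tr a (c z) x"
  by (induction arbitrary: z rule: cen.induct) (auto simp: tr_add_left tr_diff tr_right_comm)

text \<open>Induction on one operator reduces this to \<open>cen_tr\<close>, whose case of a right
  multiplication is the third identity.\<close>

lemma cen_commute: "c \<in> cen \<Longrightarrow> d \<in> cen \<Longrightarrow> c (d z) = d (c z)"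
  by (induction arbitrary: z rule: cen.induct) (auto simp: cen_tr cen_plus cen_minus cen_0)

text \<open>Left multiplication by \<open>y\<close> acts on \<^const>\<open>cen\<close> as the derivation \<open>y \<partial>\<^sub>a\<close>, by commutators.\<close>

lemma cen_commutator:
  "c \<in> cen \<Longrightarrow> (\<lambda>z. tr a y (c z) - c (tr a y z)) \<in> cen"
proof (induction rule: cen.induct)
  case (right b x)
  \<comment> \<open>In differential terms both sides are
    \<open>y z \<partial>\<^sub>a \<partial>\<^sub>b x\<close>; the right one reads \<open>z
    \<partial>\<^sub>b (y \<partial>\<^sub>a x) - z (\<partial>\<^sub>b y) (\<partial>\<^sub>a
    x)\<close>, where only right multiplications act on \<open>z\<close>.\<close>
  have "tr a y (tr b z x) - tr b (tr a y z) x = tr b z (tr a y x) - tr a (tr b z y) x" for z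
    using tr_assoc_swap_left[of b a y z x] tr_assoc_swap_index[of b a z y x]
    by (simp add: algebra_simps)
  moreover have "(\<lambda>z. tr b z (tr a y x) - tr a (tr b z y) x) \<in> cen"
    by (rule cen.diff[OF cen.right cen.comp[OF cen.right cen.right]])
  ultimately show ?case by (simp only:)
next
  case (add c d)
  have "(\<lambda>z. (tr a y (c z) - c (tr a y z)) + (tr a y (d z) - d (tr a y z))) \<in> cen"
    by (rule cen.add[OF add.IH])
  then show ?case by (simp add: tr_add_right algebra_simps)
next
  case (diff c d)
  have "(\<lambda>z. (tr a y (c z) - c (tr a y z)) - (tr a y (d z) - d (tr a y z))) \<in> cen"
    by (rule cen.diff[OF diff.IH])
  then show ?case by (simp add: tr_diff algebra_simps)
next
  case (comp c d)
  \<comment> \<open>Commutators obey the Leibniz rule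
    \<open>[L, c d] = [L, c] d + c [L, d]\<close>.\<close>
  have "(\<lambda>z. (tr a y (c (d z)) - c (tr a y (d z))) + c (tr a y (d z) - d (tr a y z))) \<in> cen"
    by (rule cen.add[OF cen.comp[OF comp.IH(1) comp.hyps(2)] cen.comp[OF comp.hyps(1) comp.IH(2)]])
  then show ?case using comp by (simp add: cen_minus)
qed (simp_all add: cen.zero)

text \<open>Both sides stand for \<open>y z \<partial>\<^sub>a c\<close>. For right multiplications
  this is the first identity; for a composition, the commutator with the first factor lies in
  \<open>cen\<close> and so commutes with the second.\<close>

lemma cen_commutator_swap:
  "c \<in> cen \<Longrightarrow> tr a y (c z) - c (tr a y z) = tr a z (c y) - c (tr a z y)"
proof (induction arbitrary: y z rule: cen.induct)
  case (right b x)
  show ?case using tr_assoc_swap_left[of b a y z x] by (simp add: algebra_simps)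
next
  case (add c d)
  from add.IH(1)[of y z] add.IH(2)[of y z] show ?case
    by (simp add: tr_add_right algebra_simps)
next
  case (diff c d)
  have "tr a y (c z) - c (tr a y z) - (tr a y (d z) - d (tr a y z))
      = tr a z (c y) - c (tr a z y) - (tr a z (d y) - d (tr a z y))"
    by (simp only: diff.IH)
  then show ?case by (simp add: tr_diff algebra_simps)
next
  case (comp c d)
  define D where "D y z = tr a y (c z) - c (tr a y z)" for y z
  have D: "D y \<in> cen" for y
    unfolding D_def by (rule cen_commutator[OF comp.hyps(1)])
  have Dsym: "D y z = D z y" for y z
    unfolding D_def by (rule comp.IH(1))
  have "D y (d z) = d (D y z)" by (rule cen_commute[OF D comp.hyps(2)])
  also have "\<dots> = D z (d y)" by (subst Dsym) (rule cen_commute[OF comp.hyps(2) D])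
  finally have "D y (d z) + c (tr a y (d z) - d (tr a y z))
      = D z (d y) + c (tr a z (d y) - d (tr a z y))"
    using comp.IH(2) by simp
  then show ?case using comp.hyps by (simp add: D_def cen_minus)
qed (auto intro: cen.intros)


section \<open>Homogeneous elements as symmetric multilinear maps\<close>

text \<open>An element \<open>f\<close> of weight \<open>n - 1\<close> of the differential polynomial algebra, where
  \<open>\<partial>\<^sub>a\<close> has weight \<open>1\<close> and a generator has weight \<open>-1\<close>, is encoded by the
  map \<open>{y\<^sub>1, \<dots>, y\<^sub>n} \<mapsto> y\<^sub>1 \<cdots> y\<^sub>n f\<close>, whose value has weight \<open>-1\<close>.\<close>

definition adm :: "nat \<Rightarrow> (('k::field, 'a, 'x) nov multiset \<Rightarrow> ('k, 'a, 'x) nov) \<Rightarrow> bool" where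
  "adm n F \<longleftrightarrow> (\<forall>Y. size Y \<noteq> n \<longrightarrow> F Y = 0) \<and>
     (\<forall>Y. Suc (size Y) = n \<longrightarrow> (\<lambda>z. F (add_mset z Y)) \<in> cen)"

lemma adm_zero: "adm n F \<Longrightarrow> size Y \<noteq> n \<Longrightarrow> F Y = 0"
  by (simp add: adm_def)

lemma adm_cen:
  assumes "adm n F"
  shows "(\<lambda>z. F (add_mset z Y)) \<in> cen"
proof (cases "Suc (size Y) = n")
  case False
  then have "(\<lambda>z. F (add_mset z Y)) = (\<lambda>z. 0)"
    using adm_zero[OF assms] by auto
  then show ?thesis by (simp only: cen.zero)
qed (use assms in \<open>simp add: adm_def\<close>)

text \<open>For \<open>L = y \<partial>\<^sub>a\<close> this is the product rule for \<open>L (z\<^sub>1 \<cdots> z\<^sub>n f)\<close>, solved for the term in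
  which \<open>\<partial>\<^sub>a\<close> hits \<open>f\<close>.\<close>

definition lie :: "('n \<Rightarrow> 'n) \<Rightarrow> ('n multiset \<Rightarrow> 'n) \<Rightarrow> 'n multiset \<Rightarrow> 'n::ab_group_add" where
  "lie L F Z = L (F Z) - (\<Sum>z\<in>#Z. F (add_mset (L z) (Z - {#z#})))"

lemma lie_add_mset:
  "lie L F (add_mset y Z) = L (F (add_mset y Z)) - F (add_mset (L y) Z)
    - (\<Sum>z\<in>#Z. F (add_mset y (add_mset (L z) (Z - {#z#}))))"
proof -
  have "(\<Sum>z\<in>#Z. F (add_mset (L z) (add_mset y Z - {#z#})))
      = (\<Sum>z\<in>#Z. F (add_mset y (add_mset (L z) (Z - {#z#}))))"
    by (intro sum_mset_eqI)
      (simp add: add_mset_commute)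
  then show ?thesis by (simp add: lie_def algebra_simps)
qed

text \<open>Both sums run over the ordered pairs of distinct positions in \<open>Z\<close>.\<close>

lemma sum_mset_remove_swap:
  fixes g :: "'b \<Rightarrow> 'b \<Rightarrow> 'n::comm_monoid_add"
  shows "(\<Sum>z\<in>#Z. \<Sum>w\<in>#Z - {#z#}. g z w) = (\<Sum>z\<in>#Z. \<Sum>w\<in>#Z - {#z#}. g w z)"
proof (induction Z)
  case (add x Z)
  have "(\<Sum>z\<in>#Z. \<Sum>w\<in>#add_mset x Z - {#z#}. h z w)
      = (\<Sum>z\<in>#Z. h z x) + (\<Sum>z\<in>#Z. \<Sum>w\<in>#Z - {#z#}. h z w)" for h :: "'b \<Rightarrow> 'b \<Rightarrow> 'n"
    unfolding sum_mset.distrib[symmetric]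
    by (intro sum_mset_eqI) simp
  from this[of g] this[of "\<lambda>z w. g w z"] show ?case
    by (simp add: add add.assoc add.left_commute)
qed simp

lemma sum_mset_diff:
  fixes f :: "'b \<Rightarrow> 'n::ab_group_add"
  shows "(\<Sum>i\<in>#I. f i - g i) = (\<Sum>i\<in>#I. f i) - (\<Sum>i\<in>#I. g i)"
  by (induction I) (simp_all add: algebra_simps)

lemma lie_lie:
  assumes "additive L"
  shows "lie L (lie M F) Z = L (M (F Z)) - (\<Sum>z\<in>#Z. L (F (add_mset (M z) (Z - {#z#}))))
    - (\<Sum>z\<in>#Z. M (F (add_mset (L z) (Z - {#z#}))))
    + (\<Sum>z\<in>#Z. F (add_mset (M (L z)) (Z - {#z#})))
    + (\<Sum>z\<in>#Z. \<Sum>w\<in>#Z - {#z#}. F (add_mset (L z) (add_mset (M w) (Z - {#z#} - {#w#}))))"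
  unfolding lie_def[of L] lie_add_mset
  by (simp add: lie_def additive.diff[OF assms] additive_sum_mset[OF assms] sum_mset_diff)

text \<open>The mixed terms of \<open>lie_lie\<close> are symmetric in \<open>L\<close> and
  \<open>M\<close> and cancel. The commutator has the form \<open>N - P\<close> because that of two
  left multiplications is a difference of left multiplications, by
  \<open>tr_commutator\<close>.\<close>

lemma lie_commutator:
  fixes F :: "'n multiset \<Rightarrow> 'n::ab_group_add"
  assumes "additive L" "additive M"
    and LM: "\<And>z. L (M z) - M (L z) = N z - P z"
    and F: "\<And>Z. additive (\<lambda>z. F (add_mset z Z))"
  shows "lie L (lie M F) Z - lie M (lie L F) Z = lie N F Z - lie P F Z"
proof -
  have swap: "(\<Sum>z\<in>#Z. \<Sum>w\<in>#Z - {#z#}. F (add_mset (L z) (add_mset (M w) (Z - {#z#} - {#w#}))))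
    = (\<Sum>z\<in>#Z. \<Sum>w\<in>#Z - {#z#}. F (add_mset (M z) (add_mset (L w) (Z - {#z#} - {#w#}))))"
    by (subst sum_mset_remove_swap) (simp add: add_mset_commute diff_right_commute)
  have comp: "(\<Sum>z\<in>#Z. F (add_mset (M (L z)) (Z - {#z#})))
      - (\<Sum>z\<in>#Z. F (add_mset (L (M z)) (Z - {#z#})))
    = (\<Sum>z\<in>#Z. F (add_mset (P z) (Z - {#z#}))) - (\<Sum>z\<in>#Z. F (add_mset (N z) (Z - {#z#})))"
  proof -
    have "M (L z) - L (M z) = P z - N z" for z
      using LM[of z] by (simp add: algebra_simps)
    then show ?thesis
      by (simp add: sum_mset_diff[symmetric] additive.diff[OF F, symmetric])
  qed
  have cancel: "a - s - t + p + q - (b - t - s + p' + q) = n - u - (m - v)"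
    if "a - b = n - m" "p - p' = v - u" for a b m n p p' q s t u v :: 'n
  proof -
    have "a = b + (n - m)" "p = p' + (v - u)"
      using that by (simp_all add: diff_eq_eq add.commute)
    then show ?thesis by simp
  qed
  show ?thesis
    unfolding lie_lie[OF assms(1)] lie_lie[OF assms(2)] lie_def[of N] lie_def[of P] swap
    by (rule cancel[OF LM comp])
qed

section \<open>Commuting derivations of the multilinear maps\<close>

abbreviation pd where "pd a F y \<equiv> lie (tr a y) F"

text \<open>\<open>pd a F y Z\<close> stands for the product of \<open>y\<close>, the entries of
  \<open>Z\<close> and \<open>\<partial>\<^sub>a f\<close>. In \<open>lie_add_mset\<close> the first
  two terms form a commutator with an operator from \<open>cen\<close>; the terms of the sum are
  symmetric because each slot of \<open>F\<close> commutes with right multiplications.\<close>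

lemma pd_swap:
  assumes "adm n F"
  shows "pd a F y (add_mset y' K) = pd a F y' (add_mset y K)"
proof -
  have right: "F (add_mset (tr a y z) Y) = tr a (F (add_mset y Y)) z" for y z Y
    using cen_tr[OF adm_cen[OF assms, of Y]] by metis
  have "F (add_mset y' (add_mset (tr a y z) K)) = F (add_mset y (add_mset (tr a y' z) K))" for z K
    by (simp add: add_mset_commute[of y' "tr a y z"] add_mset_commute[of y "tr a y' z"] right
        add_mset_commute[of y' y])
  moreover have "tr a y (F (add_mset y' K)) - F (add_mset (tr a y y') K)
      = tr a y' (F (add_mset y K)) - F (add_mset (tr a y' y) K)"
    by (rule cen_commutator_swap[OF adm_cen[OF assms]])
  ultimately show ?thesis
    by (simp add: lie_add_mset)
qed

text \<open>By \<open>pd_swap\<close> any entry may be split off to carry the derivation. The empty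
  multiset gets 0, since a derivative has positive arity.\<close>

definition der_map ::
  "'a \<Rightarrow> (('k::field, 'a, 'x) nov multiset \<Rightarrow> ('k, 'a, 'x) nov) \<Rightarrow> ('k, 'a, 'x) nov multiset \<Rightarrow> ('k, 'a, 'x) nov"
  where
  "der_map a F Y =
     (if Y = {#} then 0 else let y = (SOME y. y \<in># Y) in pd a F y (Y - {#y#}))"

lemma der_map_add_mset:
  assumes "adm n F"
  shows "der_map a F (add_mset y Z) = pd a F y Z"
proof -
  let ?Y = "add_mset y Z"
  define x where "x = (SOME x. x \<in># ?Y)"
  have x: "x \<in># ?Y"
    unfolding x_def by (rule someI[of _ y]) simp
  have "pd a F x (?Y - {#x#}) = pd a F y Z"
  proof (cases "x = y")
    case False
    with x obtain K where "Z = add_mset x K"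
      by (auto dest: multi_member_split)
    with False show ?thesis by (simp add: pd_swap[OF assms])
  qed simp
  then show ?thesis unfolding der_map_def Let_def x_def[symmetric] by simp
qed

lemma adm_der_map:
  fixes F :: "('k::field, 'a, 'x) nov multiset \<Rightarrow> ('k, 'a, 'x) nov"
  assumes "adm n F"
  shows "adm (Suc n) (der_map a F)"
  unfolding adm_def
proof (intro conjI allI impI)
  fix Y :: "('k, 'a, 'x) nov multiset"
  assume Y: "size Y \<noteq> Suc n"
  show "der_map a F Y = 0"
  proof (cases Y)
    case (add y Z)
    with Y have "size Z \<noteq> n" by simp
    moreover have "size (add_mset w (Z - {#z#})) = size Z" if "z \<in># Z" for w z
      using that by (metis insert_DiffM size_add_mset)
    ultimately have "(\<Sum>z\<in>#Z. F (add_mset (tr a y z) (Z - {#z#}))) = 0"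
      using adm_zero[OF assms] by (intro sum_mset.neutral) auto
    with \<open>size Z \<noteq> n\<close> add show ?thesis
      by (simp add: der_map_add_mset[OF assms] lie_def adm_zero[OF assms])
  qed (simp add: der_map_def)
next
  fix Y :: "('k, 'a, 'x) nov multiset"
  assume "Suc (size Y) = Suc n"
  show "(\<lambda>z. der_map a F (add_mset z Y)) \<in> cen"
  proof (cases Y)
    case empty
    then show ?thesis by (simp add: der_map_add_mset[OF assms] lie_def cen.right)
  next
    case (add y K)
    \<comment> \<open>Splitting off \<open>y\<close> rather than \<open>z\<close> shows the
      dependence on \<open>z\<close> as a commutator with an operator from \<open>cen\<close>, minus
      operators from \<open>cen\<close>.\<close>
    have "(\<lambda>z. tr a y (F (add_mset z K)) - F (add_mset (tr a y z) K)
        - (\<Sum>w\<in>#K. F (add_mset z (add_mset (tr a y w) (K - {#w#}))))) \<in> cen"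
      by (intro cen.diff[OF cen_commutator[OF adm_cen[OF assms]]] cen_sum_mset adm_cen[OF assms])
    then show ?thesis
      by (simp add: add add_mset_commute[of _ y] der_map_add_mset[OF assms] lie_add_mset)
  qed
qed

text \<open>This is the bracket of the vector fields \<open>x \<partial>\<^sub>a\<close> and
  \<open>y \<partial>\<^sub>b\<close>; the first two identities together give it.\<close>

lemma tr_commutator:
  "tr a x (tr b y z) - tr b y (tr a x z) = tr b (tr a x y) z - tr a (tr b y x) z"
  using tr_assoc_swap_left[of b a x y z] tr_assoc_swap_index[of b a y x z]
  by (simp add: algebra_simps)

text \<open>The Leibniz rule for \<open>x \<partial>\<^sub>a (y \<partial>\<^sub>b f)\<close>,
  solved for \<open>x y \<partial>\<^sub>a \<partial>\<^sub>b f\<close>.\<close>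

lemma der_map_der_map:
  assumes "adm n F"
  shows "der_map a (der_map b F) (add_mset x (add_mset y Z))
    = pd a (pd b F y) x Z - pd b F (tr a x y) Z"
proof -
  have "der_map a (der_map b F) (add_mset x (add_mset y Z))
      = pd a (der_map b F) x (add_mset y Z)"
    by (rule der_map_add_mset[OF adm_der_map[OF assms]])
  then show ?thesis
    by (simp add: lie_add_mset der_map_add_mset[OF assms] lie_def[of "tr a x"])
qed

text \<open>With \<open>x\<close> carrying \<open>a\<close> and \<open>y\<close> carrying
  \<open>b\<close> on both sides, the difference of the expansions vanishes by
  \<open>lie_commutator\<close> for the bracket in \<open>tr_commutator\<close>.\<close>

lemma der_map_commute:
  assumes "adm n F"
  shows "der_map a (der_map b F) Y = der_map b (der_map a F) Y"
proof (cases "size Y = Suc (Suc n)")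
  case True
  then obtain x y Z where Y: "Y = add_mset x (add_mset y Z)"
    using size_eq_Suc_imp_eq_union[OF True] size_eq_Suc_imp_eq_union[where n = n]
    by (metis True size_add_mset old.nat.inject)
  have "pd a (pd b F y) x Z - pd b (pd a F x) y Z = pd b F (tr a x y) Z - pd a F (tr b y x) Z"
    by (rule lie_commutator)
      (simp_all add: additive_tr tr_commutator cen_additive[OF adm_cen[OF assms]])
  then have "der_map a (der_map b F) (add_mset x (add_mset y Z))
      = der_map b (der_map a F) (add_mset y (add_mset x Z))"
    unfolding der_map_der_map[OF assms] by (simp add: algebra_simps)
  then show ?thesis by (simp only: Y add_mset_commute[of y x])
qed (simp add: adm_zero[OF adm_der_map[OF adm_der_map[OF assms]]])


section \<open>Homogeneous elements as a type\<close>

text \<open>The arity is recorded because the zero map is admissible for every arity. Sums are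
  formed only of values, so the Leibniz rules below are pointwise.\<close>

typedef (overloaded) ('k::field, 'a, 'x) gr =
  "{(n, F :: ('k, 'a, 'x) nov multiset \<Rightarrow> ('k, 'a, 'x) nov). adm n F}"
proof
  show "(0, \<lambda>_. 0) \<in> {(n, F :: ('k, 'a, 'x) nov multiset \<Rightarrow> ('k, 'a, 'x) nov). adm n F}"
    by (simp add: adm_def cen.zero)
qed

setup_lifting type_definition_gr

lift_definition ar :: "('k::field, 'a, 'x) gr \<Rightarrow> nat" is fst .
lift_definition ap :: "('k::field, 'a, 'x) gr \<Rightarrow> ('k, 'a, 'x) nov multiset \<Rightarrow> ('k, 'a, 'x) nov"
  is snd .

lemma adm_ap: "adm (ar f) (ap f)"
  by transfer auto

lemma gr_eqI:
  assumes "ar f = ar g" "\<And>Y. size Y = ar f \<Longrightarrow> ap f Y = ap g Y"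
  shows "f = g"
proof -
  have "ap f = ap g"
    using assms adm_zero[OF adm_ap[of f]] adm_zero[OF adm_ap[of g]] by (metis ext)
  with assms(1) show ?thesis
    by transfer (auto simp: prod_eq_iff)
qed

lemmas ap_cen = adm_cen[OF adm_ap]
lemmas ap_minus = cen_minus[OF ap_cen]
lemmas ap_additive = cen_additive[OF ap_cen]

lift_definition gen :: "('k::field, 'a, 'x) nov \<Rightarrow> ('k, 'a, 'x) gr" is
  "\<lambda>x. (0, \<lambda>Y. if Y = {#} then x else 0)"
  by (auto simp: adm_def)

lift_definition gr_der :: "'a \<Rightarrow> ('k::field, 'a, 'x) gr \<Rightarrow> ('k, 'a, 'x) gr" is
  "\<lambda>a (n, F). (Suc n, der_map a F)"
  by (auto intro: adm_der_map)

lift_definition gr_one :: "('k::field, 'a, 'x) gr" is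
  "(1, \<lambda>Y. if size Y = 1 then (THE y. Y = {#y#}) else 0)"
  by (auto simp: adm_def cen.id)

lemma ar_gr_der [simp]: "ar (gr_der a f) = Suc (ar f)"
  by transfer auto

lemma ap_gr_der: "ap (gr_der a f) (add_mset y Z) = pd a (ap f) y Z"
  by transfer (auto simp: der_map_add_mset)

lemma ar_gen [simp]: "ar (gen x) = 0"
  by transfer simp

lemma ap_gen [simp]: "ap (gen x) {#} = x"
  by transfer simp

lemma ar_gr_one [simp]: "ar gr_one = 1"
  by transfer simp

lemma ap_gr_one [simp]: "ap gr_one {#y#} = y"
  by transfer simp

lemma gr_der_commute: "gr_der a (gr_der b f) = gr_der b (gr_der a f)"
  by transfer (auto intro: der_map_commute)

section \<open>Distributing arguments between two factors\<close>

lemma ex_subset_mset_size: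
  fixes Y :: "'b multiset"
  shows "n \<le> size Y \<Longrightarrow> \<exists>K. K \<subseteq># Y \<and> size K = n"
proof (induction Y arbitrary: n)
  case (add y Y)
  show ?case
  proof (cases n)
    case 0
    then show ?thesis by (intro exI[of _ "{#}"]) simp
  next
    case (Suc m)
    with add.prems add.IH[of m] obtain K where "K \<subseteq># Y" "size K = m" by auto
    with Suc show ?thesis by (intro exI[of _ "add_mset y K"]) simp
  qed
qed simp

lemma mset_splitE:
  fixes Y :: "'b multiset"
  assumes "size Y = m + n"
  obtains K M where "Y = K + M" "size K = m" "size M = n"
proof -
  obtain K where "K \<subseteq># Y" "size K = m"
    using ex_subset_mset_size[of m Y] assms by auto
  then show thesis
    by (intro that[of K "Y - K"]) (use assms in \<open>auto simp: size_Diff_submset\<close>)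
qed

lemma mset_split_SucE:
  fixes Y :: "'b multiset"
  assumes "size Y = Suc (m + n)"
  obtains y K M where "Y = add_mset y (K + M)" "size K = m" "size M = n"
proof -
  obtain y Z where "Y = add_mset y Z" "size Z = m + n"
    using assms size_eq_Suc_imp_eq_union[OF assms] by auto
  then show thesis
    by (elim mset_splitE) (auto intro: that)
qed

text \<open>Exchanges of single entries connect any two splittings with parts of the same sizes. The
  induction settles one entry \<open>y\<close> of the left part at a time; if the target has
  \<open>y\<close> on the right, one exchange brings it to the left.\<close>

lemma split_mset_eq:
  assumes "\<And>y y' K M. h (add_mset y K) (add_mset y' M) = h (add_mset y' K) (add_mset y M)"
    and "A + B = A' + B'" "size A = size A'"
  shows "h A B = h A' B'"
  using assms
proof (induction A arbitrary: h A' B B')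
  case empty
  then show ?case by simp
next
  case (add y A)
  have step: "h (add_mset y A) B = h (add_mset y K) M"
    if "A + B = K + M" "size A = size K" for K M
    by (rule add.IH[where h = "\<lambda>A. h (add_mset y A)"])
      (use that add.prems(1) in \<open>simp_all add: add_mset_commute[of y]\<close>)
  show ?case
  proof (cases "y \<in># A'")
    case True
    then obtain K where "A' = add_mset y K" by (blast dest: multi_member_split)
    with step[of K B'] add.prems(2,3) show ?thesis by simp
  next
    case False
    moreover have "y \<in># A' + B'"
      using add.prems(2) by (metis union_mset_add_mset_left union_single_eq_member)
    ultimately obtain M where B': "B' = add_mset y M" by (auto dest: multi_member_split)
    from add.prems(3) obtain y' K where A': "A' = add_mset y' K"
      by (metis size_eq_Suc_imp_eq_union size_add_mset)
    from step[of K "add_mset y' M"] add.prems(2,3) show ?thesis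
      by (simp add: A' B' add.prems(1)[of y'])
  qed
qed

text \<open>A product with a factor of weight \<open>-1\<close> may have weight below \<open>-1\<close> and is given the junk
  value \<open>0\<close>, of arity \<open>0\<close>. Associativity and commutativity survive this.\<close>

definition mul_map ::
  "('k::field, 'a, 'x) gr \<Rightarrow> ('k, 'a, 'x) gr \<Rightarrow> ('k, 'a, 'x) nov multiset \<Rightarrow> ('k, 'a, 'x) nov" where
  "mul_map f g Y =
     (if 0 < ar f \<and> 0 < ar g \<and> Suc (size Y) = ar f + ar g
      then let Z = (SOME Z. Z \<subseteq># Y \<and> size Z = ar g) in ap f (add_mset (ap g Z) (Y - Z)) else 0)"

lemma ap_ap_swap:
  "ap f (add_mset (ap g (add_mset y K)) M) = ap g (add_mset (ap f (add_mset y M)) K)"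
  using cen_commute[OF ap_cen[of f M] ap_cen[of g K]] by simp

lemma mul_map_union:
  assumes "size Z = ar g" "Suc (size Y) = ar f" "0 < ar g"
  shows "mul_map f g (Z + Y) = ap f (add_mset (ap g Z) Y)"
proof -
  let ?P = "\<lambda>W. W \<subseteq># Z + Y \<and> size W = ar g"
  let ?W = "SOME W. ?P W"
  have W: "?P ?W"
    by (rule someI[of _ Z]) (simp add: assms(1))
  have "ap f (add_mset (ap g ?W) (Z + Y - ?W)) = ap f (add_mset (ap g Z) Y)"
  proof (rule split_mset_eq[where h = "\<lambda>Z Y. ap f (add_mset (ap g Z) Y)"])
    \<comment> \<open>After \<open>ap_ap_swap\<close> both \<open>y\<close> and \<open>y'\<close>
      are arguments of \<open>f\<close>, where their order is invisible.\<close>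
    show "ap f (add_mset (ap g (add_mset y K)) (add_mset y' M))
        = ap f (add_mset (ap g (add_mset y' K)) (add_mset y M))" for y y' K M
      unfolding ap_ap_swap[of f g y K "add_mset y' M"] ap_ap_swap[of f g y' K "add_mset y M"]
      by (simp only: add_mset_commute)
    show "?W + (Z + Y - ?W) = Z + Y" using W by (intro subset_mset.add_diff_inverse) (rule conjunct1)
    show "size ?W = size Z" unfolding assms(1) using W by (rule conjunct2)
  qed
  with assms show ?thesis
    by (simp add: mul_map_def Let_def)
qed

text \<open>Weights \<open>n - 1\<close> and \<open>m - 1\<close> add up to
  \<open>n + m - 2\<close>, the weight of arity \<open>n + m - 1\<close>. With the free slot placed
  inside \<open>g\<close>, the product is a composition of two operators from
  \<open>cen\<close>.\<close>

lemma adm_mul_map: "adm (if 0 < ar f \<and> 0 < ar g then ar f + ar g - 1 else 0) (mul_map f g)"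
proof (cases "0 < ar f \<and> 0 < ar g")
  case True
  have "(\<lambda>z. mul_map f g (add_mset z Y)) \<in> cen" if Y: "Suc (size Y) = ar f + ar g - 1" for Y
  proof -
    from Y True have "size Y = (ar g - 1) + (ar f - 1)" by simp
    then obtain K M where "Y = K + M" "size K = ar g - 1" "size M = ar f - 1"
      by (rule mset_splitE)
    with True have KM: "Y = K + M" "Suc (size K) = ar g" "Suc (size M) = ar f" by auto
    have "(\<lambda>z. mul_map f g (add_mset z Y)) = (\<lambda>z. ap f (add_mset (ap g (add_mset z K)) M))"
      using mul_map_union[of "add_mset _ K" g M f] KM by auto
    also have "\<dots> \<in> cen"
      by (rule cen.comp[OF ap_cen[of f] ap_cen[of g]])
    finally show ?thesis .
  qed
  with True show ?thesis
    by (auto simp: adm_def mul_map_def)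
next
  case False
  then have "mul_map f g = (\<lambda>_. 0)" by (auto simp: mul_map_def)
  with False show ?thesis by (auto simp: adm_def)
qed


instantiation gr :: (field, type, type) ab_semigroup_mult
begin

lift_definition times_gr :: "('a, 'b, 'c) gr \<Rightarrow> ('a, 'b, 'c) gr \<Rightarrow> ('a, 'b, 'c) gr" is
  "\<lambda>f g. (if 0 < ar f \<and> 0 < ar g then ar f + ar g - 1 else 0, mul_map f g)"
  by (simp only: mem_Collect_eq prod.case) (rule adm_mul_map)

lemma ar_mult: "ar (f * g) = (if 0 < ar f \<and> 0 < ar g then ar f + ar g - 1 else 0)"
  by (simp add: ar.rep_eq times_gr.rep_eq)

lemma ap_mult_union:
  assumes "size Z = ar g" "Suc (size Y) = ar f" "0 < ar g"
  shows "ap (f * g) (Z + Y) = ap f (add_mset (ap g Z) Y)"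
  using mul_map_union[OF assms] by (simp add: ap.rep_eq times_gr.rep_eq)

lemma ap_mult_0: "ar f = 0 \<or> ar g = 0 \<Longrightarrow> ap (f * g) Y = 0"
  by (auto simp: ap.rep_eq times_gr.rep_eq mul_map_def)

instance
proof
  fix f g h :: "('a, 'b, 'c) gr"
  show "f * g * h = f * (g * h)"
  proof (cases "0 < ar f \<and> 0 < ar g \<and> 0 < ar h")
    case True
    show ?thesis
    proof (rule gr_eqI)
      show "ar (f * g * h) = ar (f * (g * h))"
        using True by (simp add: ar_mult)
      fix Y :: "('a, 'b, 'c) nov multiset" assume "size Y = ar (f * g * h)"
      with True have "size Y = ar h + ((ar g - 1) + (ar f - 1))"
        by (simp add: ar_mult)
      then obtain K M N where Y: "Y = K + (M + N)"
        and "size K = ar h" "size M = ar g - 1" "size N = ar f - 1"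
        by (elim mset_splitE) blast
      with True have *: "size K = ar h" "Suc (size M) = ar g" "Suc (size N) = ar f" by auto
      have "ap (f * g * h) (K + (M + N)) = ap (f * g) (add_mset (ap h K) M + N)"
        using True * by (subst ap_mult_union) (simp_all add: ar_mult)
      also have "\<dots> = ap f (add_mset (ap g (add_mset (ap h K) M)) N)"
        using True * by (intro ap_mult_union) simp_all
      also have "\<dots> = ap f (add_mset (ap (g * h) (K + M)) N)"
        using True * by (simp add: ap_mult_union)
      also have "\<dots> = ap (f * (g * h)) (K + M + N)"
        using True * by (subst ap_mult_union) (simp_all add: ar_mult)
      finally show "ap (f * g * h) Y = ap (f * (g * h)) Y"
        by (simp add: Y add.assoc)
    qed
  next
    case False
    then show ?thesis
      by (intro gr_eqI) (auto simp: ar_mult ap_mult_0)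
  qed
  show "f * g = g * f"
  proof (cases "0 < ar f \<and> 0 < ar g")
    case True
    show ?thesis
    proof (rule gr_eqI)
      show "ar (f * g) = ar (g * f)"
        using True by (simp add: ar_mult)
      fix Y :: "('a, 'b, 'c) nov multiset" assume "size Y = ar (f * g)"
      with True have "size Y = Suc ((ar g - 1) + (ar f - 1))"
        by (simp add: ar_mult) arith
      then obtain y K M where Y: "Y = add_mset y (K + M)"
        and "size K = ar g - 1" "size M = ar f - 1"
        by (rule mset_split_SucE)
      with True have *: "Suc (size K) = ar g" "Suc (size M) = ar f"
        by auto
      have "ap (f * g) (add_mset y K + M) = ap f (add_mset (ap g (add_mset y K)) M)"
        using True * by (intro ap_mult_union) simp_all
      also have "\<dots> = ap g (add_mset (ap f (add_mset y M)) K)"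
        by (rule ap_ap_swap)
      also have "\<dots> = ap (g * f) (add_mset y M + K)"
        using True * by (intro ap_mult_union[symmetric]) simp_all
      finally show "ap (f * g) Y = ap (g * f) Y"
        by (simp add: Y add.commute)
    qed
  next
    case False
    then show ?thesis
      by (intro gr_eqI) (auto simp: ar_mult ap_mult_0)
  qed
qed

end

lemma gr_one_mult:
  fixes f :: "('a::field, 'b, 'c) gr"
  assumes "0 < ar f"
  shows "gr_one * f = f"
proof (rule gr_eqI)
  show "ar (gr_one * f) = ar f"
    using assms by (simp add: ar_mult)
  fix Y :: "('a, 'b, 'c) nov multiset" assume "size Y = ar (gr_one * f)"
  with assms show "ap (gr_one * f) Y = ap f Y"
    using ap_mult_union[of Y f "{#}" gr_one] by (simp add: ar_mult)
qed

text \<open>Of the arguments, \<open>y\<close> carries the derivation, \<open>K\<close> is fed to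
  \<open>g\<close>, and \<open>M\<close> fills the remaining slots of \<open>f\<close>. In the first
  summand on the right the value of \<open>g\<close> is an argument of
  \<open>\<partial>\<^sub>a f\<close>; the term in which \<open>y \<partial>\<^sub>a\<close> hits
  that value occurs in both summands with opposite signs.\<close>

lemma gr_leibniz:
  fixes f g :: "('a::field, 'b, 'c) gr"
  assumes f: "0 < ar f" and g: "0 < ar g" and Y: "size Y = ar f + ar g"
  shows "ap (gr_der a (f * g)) Y = ap (gr_der a f * g) Y + ap (f * gr_der a g) Y"
proof -
  from Y f have "size Y = Suc (ar g + (ar f - 1))" by simp
  then obtain y K M where Y: "Y = add_mset y (K + M)"
    and "size K = ar g" "size M = ar f - 1"
    by (rule mset_split_SucE)
  with f have KM: "size K = ar g" "Suc (size M) = ar f"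
    by auto
  let ?L = "tr a y"
  let ?gK = "\<Sum>z\<in>#K. ap g (add_mset (?L z) (K - {#z#}))"
  let ?fM = "\<Sum>z\<in>#M. ap f (add_mset (ap g K) (add_mset (?L z) (M - {#z#})))"
  have resize: "Suc (size (N - {#z#})) = size N" if "z \<in># N" for z and N :: "('a, 'b, 'c) nov multiset"
    using that by (metis insert_DiffM size_add_mset)
  have sumK: "(\<Sum>z\<in>#K. ap (f * g) (add_mset (?L z) (K + M - {#z#}))) = ap f (add_mset ?gK M)"
  proof -
    have "ap (f * g) (add_mset (?L z) (K + M - {#z#}))
        = ap f (add_mset (ap g (add_mset (?L z) (K - {#z#}))) M)" if "z \<in># K" for z
    proof -
      have "size (add_mset (?L z) (K - {#z#})) = ar g"
        unfolding size_add_mset resize[OF that] by (rule KM(1))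
      then have "ap (f * g) (add_mset (?L z) (K - {#z#}) + M)
          = ap f (add_mset (ap g (add_mset (?L z) (K - {#z#}))) M)"
        using KM(2) g by (rule ap_mult_union)
      moreover have "add_mset (?L z) (K - {#z#}) + M = add_mset (?L z) (K + M - {#z#})"
        using that by (auto dest!: multi_member_split)
      ultimately show ?thesis by (simp only:)
    qed
    then show ?thesis
      unfolding additive_sum_mset[OF ap_additive] by (rule sum_mset_eqI)
  qed
  have sumM: "(\<Sum>z\<in>#M. ap (f * g) (add_mset (?L z) (K + M - {#z#}))) = ?fM"
  proof -
    have "ap (f * g) (add_mset (?L z) (K + M - {#z#}))
        = ap f (add_mset (ap g K) (add_mset (?L z) (M - {#z#})))" if "z \<in># M" for z
    proof -
      have "Suc (size (add_mset (?L z) (M - {#z#}))) = ar f"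
        unfolding size_add_mset resize[OF that] by (rule KM(2))
      with KM(1) have "ap (f * g) (K + add_mset (?L z) (M - {#z#}))
          = ap f (add_mset (ap g K) (add_mset (?L z) (M - {#z#})))"
        using g by (rule ap_mult_union)
      moreover have "K + add_mset (?L z) (M - {#z#}) = add_mset (?L z) (K + M - {#z#})"
        using that by (auto dest!: multi_member_split)
      ultimately show ?thesis by (simp only:)
    qed
    then show ?thesis by (rule sum_mset_eqI)
  qed
  have "ap (gr_der a (f * g)) Y = ?L (ap (f * g) (K + M))
      - (\<Sum>z\<in>#K + M. ap (f * g) (add_mset (?L z) (K + M - {#z#})))"
    by (simp add: Y ap_gr_der lie_def)
  also have "\<dots> = ?L (ap f (add_mset (ap g K) M)) - ap f (add_mset ?gK M) - ?fM"
    using ap_mult_union[of K g M f] KM g by (simp add: sumK sumM)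
  finally have fg: "ap (gr_der a (f * g)) Y
      = ?L (ap f (add_mset (ap g K) M)) - ap f (add_mset ?gK M) - ?fM" .
  have "ap (gr_der a f * g) (K + add_mset y M) = ap (gr_der a f) (add_mset y (add_mset (ap g K) M))"
    using KM g by (subst ap_mult_union) (simp_all add: add_mset_commute)
  then have df: "ap (gr_der a f * g) Y
      = ?L (ap f (add_mset (ap g K) M)) - ap f (add_mset (?L (ap g K)) M) - ?fM"
    by (simp add: Y ap_gr_der lie_add_mset)
  have "ap (f * gr_der a g) (add_mset y K + M) = ap f (add_mset (ap (gr_der a g) (add_mset y K)) M)"
    using KM by (intro ap_mult_union) simp_all
  then have dg: "ap (f * gr_der a g) Y = ap f (add_mset (?L (ap g K)) M) - ap f (add_mset ?gK M)"
    by (simp add: Y ap_gr_der lie_def ap_minus)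
  show ?thesis
    by (simp add: fg df dg)
qed


section \<open>Finite products and their derivatives\<close>

definition gr_prod :: "('k::field, 'a, 'x) gr multiset \<Rightarrow> ('k, 'a, 'x) gr" where
  "gr_prod M = fold_mset (*) gr_one M"

lemma gr_prod_empty [simp]: "gr_prod {#} = gr_one"
  by (simp add: gr_prod_def)

lemma gr_prod_add_mset [simp]: "gr_prod (add_mset f M) = f * gr_prod M"
proof -
  interpret comp_fun_commute "(*) :: ('a, 'b, 'c) gr \<Rightarrow> _"
    by standard (simp add: fun_eq_iff mult.left_commute)
  show ?thesis by (simp add: gr_prod_def)
qed

text \<open>The weights \<open>ar f - 1\<close> add up; the equation is arranged so that no
  subtraction of naturals occurs.\<close>

lemma ar_gr_prod:
  "\<forall>f\<in>#M. 0 < ar f \<Longrightarrow> ar (gr_prod M) + size M = Suc (\<Sum>f\<in>#M. ar f)"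
proof (induction M)
  case (add f M)
  then have IH: "ar (gr_prod M) + size M = Suc (\<Sum>f\<in>#M. ar f)" by simp
  have "size M \<le> (\<Sum>f\<in>#M. ar f)"
    using sum_mset_mono[of M "\<lambda>_. 1" ar] add.prems by (simp add: Suc_le_eq)
  with IH add.prems show ?case by (simp add: ar_mult)
qed simp

lemma ar_gr_prod_pos: "\<forall>f\<in>#M. 0 < ar f \<Longrightarrow> 0 < ar (gr_prod M)"
  by (induction M) (simp_all add: ar_mult)

lemma gr_prod_union:
  "\<forall>f\<in>#N. 0 < ar f \<Longrightarrow> gr_prod (M + N) = gr_prod M * gr_prod N"
  by (induction M) (simp_all add: gr_one_mult ar_gr_prod_pos mult.assoc)

lemma gr_prod_leibniz:
  "\<forall>f\<in>#M. 0 < ar f \<Longrightarrow> size Y = Suc (ar (gr_prod M)) \<Longrightarrow>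
    ap (gr_der a (gr_prod M)) Y
      = (\<Sum>f\<in>#M. ap (gr_prod (add_mset (gr_der a f) (M - {#f#}))) Y)"
proof (induction M arbitrary: Y)
  case empty
  then have "size Y = Suc (1 + 0)" by simp
  then obtain x K M where "Y = add_mset x (K + M)" "size K = 1" "size M = 0"
    by (rule mset_split_SucE)
  moreover then obtain y where "K = {#y#}"
    using size_1_singleton_mset by blast
  ultimately have "Y = add_mset x {#y#}" by simp
  \<comment> \<open>The derivative of 1 vanishes: its value here is
    \<open>tr a x y - tr a x y\<close>.\<close>
  then show ?case by (simp add: ap_gr_der lie_def)
next
  case (add f M)
  let ?P = "gr_prod M"
  have f: "0 < ar f" and M: "\<forall>f\<in>#M. 0 < ar f" using add.prems(1) by auto
  have P: "0 < ar ?P" by (rule ar_gr_prod_pos[OF M])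
  have Y: "size Y = ar f + ar ?P" using add.prems(2) f P by (simp add: ar_mult)
  \<comment> \<open>One splitting serves all summands: the derivative of \<open>?P\<close> and every
    product with one factor of \<open>M\<close> differentiated have arity
    \<open>Suc (ar ?P)\<close>.\<close>
  obtain K N where KN: "Y = K + N" "size K = Suc (ar ?P)" "Suc (size N) = ar f"
  proof -
    have "size Y = Suc (ar ?P) + (ar f - 1)" using Y f by simp
    then show thesis using f by (elim mset_splitE) (auto intro: that)
  qed
  have shift: "ap (f * gr_prod (add_mset (gr_der a g) (M - {#g#}))) Y
      = ap f (add_mset (ap (gr_prod (add_mset (gr_der a g) (M - {#g#}))) K) N)" if g: "g \<in># M" for g
  proof -
    have "ar (gr_prod (add_mset (gr_der a g) (M - {#g#}))) = Suc (ar ?P)"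
      using ar_gr_prod[of "add_mset (gr_der a g) (M - {#g#})"] ar_gr_prod[OF M] M
        multi_member_split[OF g] by (auto dest: in_diffD)
    then show ?thesis
      using KN by (simp only: ap_mult_union)
  qed
  have "ap (gr_der a (f * ?P)) Y = ap (gr_der a f * ?P) Y + ap (f * gr_der a ?P) Y"
    by (rule gr_leibniz[OF f P Y])
  also have "ap (f * gr_der a ?P) Y = ap f (add_mset (ap (gr_der a ?P) K) N)"
    using KN by (simp add: ap_mult_union)
  also have "\<dots> = (\<Sum>g\<in>#M. ap f (add_mset (ap (gr_prod (add_mset (gr_der a g) (M - {#g#}))) K) N))"
    using add.IH[OF M KN(2)] additive_sum_mset[OF ap_additive] by simp
  also have "\<dots> = (\<Sum>g\<in>#M. ap (gr_prod (add_mset (gr_der a g) (add_mset f M - {#g#}))) Y)"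
  proof (intro sum_mset_eqI)
    fix g assume g: "g \<in># M"
    then have "gr_prod (add_mset (gr_der a g) (add_mset f M - {#g#}))
        = f * gr_prod (add_mset (gr_der a g) (M - {#g#}))"
      by (simp add: mult.left_commute)
    with shift[OF g] show "ap f (add_mset (ap (gr_prod (add_mset (gr_der a g) (M - {#g#}))) K) N)
        = ap (gr_prod (add_mset (gr_der a g) (add_mset f M - {#g#}))) Y"
      by simp
  qed
  finally show ?case by simp
qed


section \<open>Values of polynomials of weight \<open>-1\<close>\<close>

text \<open>The value of a product of weight \<open>-1\<close>: its factors of weight \<open>-1\<close>, as many as the
  arity of the product of the others, are used as arguments.\<close>

definition gval :: "('k::field, 'a, 'x) gr multiset \<Rightarrow> ('k, 'a, 'x) nov" where
  "gval W = ap (gr_prod {#f \<in># W. 0 < ar f#}) {#ap f {#}. f \<in># {#f \<in># W. ar f = 0#}#}"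

lemma gval_union:
  assumes "\<forall>f\<in>#A. 0 < ar f" "\<forall>f\<in>#B. ar f = 0"
  shows "gval (A + B) = ap (gr_prod A) {#ap f {#}. f \<in># B#}"
proof -
  have A: "{#f \<in># A. 0 < ar f#} = A" "{#f \<in># A. ar f = 0#} = {#}"
    using assms(1) by (induction A) auto
  have B: "{#f \<in># B. 0 < ar f#} = {#}" "{#f \<in># B. ar f = 0#} = B"
    using assms(2) by (induction B) auto
  show ?thesis unfolding gval_def filter_union_mset A B by simp
qed

text \<open>The hypothesis says that the weights \<open>ar f - 1\<close> add up to -1. Hence the
  factors of weight -1 are exactly as many as the product of the others takes arguments.\<close>

lemma balanced_splitE:
  fixes W :: "('k::field, 'a, 'x) gr multiset"
  assumes "size W = Suc (\<Sum>f\<in>#W. ar f)"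
  obtains A B where "W = A + B" "\<forall>f\<in>#A. 0 < ar f" "\<forall>f\<in>#B. ar f = 0" "ar (gr_prod A) = size B"
proof (rule that)
  let ?A = "{#f \<in># W. 0 < ar f#}" and ?B = "{#f \<in># W. ar f = 0#}"
  show W: "W = ?A + ?B"
    by (induction W) auto
  show A: "\<forall>f\<in>#?A. 0 < ar f" and B: "\<forall>f\<in>#?B. ar f = 0" by auto
  have "(\<Sum>f\<in>#W. ar f) = (\<Sum>f\<in>#?A + ?B. ar f)" "size W = size (?A + ?B)"
    by (rule arg_cong[OF W])+
  moreover have "(\<Sum>f\<in>#?B. ar f) = 0" using B by (intro sum_mset.neutral) auto
  ultimately have "(\<Sum>f\<in>#W. ar f) = (\<Sum>f\<in>#?A. ar f)" "size W = size ?A + size ?B"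
    by (simp_all only: image_mset_union sum_mset.union size_union add_0_right)
  with assms ar_gr_prod[OF A] show "ar (gr_prod ?A) = size ?B" by simp
qed

text \<open>The left side is the Leibniz expansion of \<open>w \<partial>\<^sub>a u\<close> for the
  products \<open>w\<close> of \<open>W\<close> and \<open>u\<close> of \<open>U\<close>.
  Differentiating factors of positive arity gives in total \<open>\<partial>\<^sub>a G\<close> at
  \<open>gval W\<close> and \<open>Z\<close>. A differentiated factor of arity 0 leaves the
  arguments and joins the product; this gives the terms in which \<open>gval W\<close> times
  \<open>\<partial>\<^sub>a\<close> hits an argument of \<open>G\<close>. By the definition of
  \<open>lie\<close> both parts add up to the right side.\<close>

lemma gval_tri:
  fixes W U :: "('k::field, 'a, 'x) gr multiset"
  assumes "size W = Suc (\<Sum>f\<in>#W. ar f)" "size U = Suc (\<Sum>f\<in>#U. ar f)"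
  shows "(\<Sum>f\<in>#U. gval (add_mset (gr_der a f) (W + (U - {#f#})))) = tr a (gval W) (gval U)"
proof -
  obtain W1 W0 where W: "W = W1 + W0" "\<forall>f\<in>#W1. 0 < ar f" "\<forall>f\<in>#W0. ar f = 0"
      "ar (gr_prod W1) = size W0"
    using assms(1) by (rule balanced_splitE)
  obtain U1 U0 where U: "U = U1 + U0" "\<forall>f\<in>#U1. 0 < ar f" "\<forall>f\<in>#U0. ar f = 0"
      "ar (gr_prod U1) = size U0"
    using assms(2) by (rule balanced_splitE)
  define F where "F = gr_prod W1"
  define G where "G = gr_prod U1"
  define ev where "ev f = ap f {#}" for f :: "('k, 'a, 'x) gr"
  define Y where "Y = image_mset ev W0"
  define Z where "Z = image_mset ev U0"
  have FY: "0 < ar F" "size Y = ar F"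
    unfolding F_def Y_def using ar_gr_prod_pos[OF W(2)] W(4) by simp_all
  have GZ: "0 < ar G" "size Z = ar G"
    unfolding G_def Z_def using ar_gr_prod_pos[OF U(2)] U(4) by simp_all
  have ev_image: "{#ap f {#}. f \<in># B#} = image_mset ev B" for B :: "('k, 'a, 'x) gr multiset"
    by (simp add: ev_def[abs_def])
  have gW: "gval W = ap F Y" and gU: "gval U = ap G Z"
    using gval_union[OF W(2,3)] gval_union[OF U(2,3)]
    by (simp_all add: W(1) U(1) F_def Y_def G_def Z_def ev_image)
  let ?y = "ap F Y"
  have pos: "gval (add_mset (gr_der a f) (W + (U - {#f#})))
      = ap (gr_prod (add_mset (gr_der a f) (U1 - {#f#}))) (add_mset ?y Z)" if f: "f \<in># U1" for f
  proof -
    obtain V where V: "U1 = add_mset f V" using multi_member_split[OF f] by blast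
    let ?H = "gr_prod (add_mset (gr_der a f) V)"
    have V_pos: "\<forall>g\<in>#add_mset (gr_der a f) V. 0 < ar g" using U(2) V by auto
    have "add_mset (gr_der a f) (W + (U - {#f#})) = (add_mset (gr_der a f) V + W1) + (W0 + U0)"
      by (simp add: U(1) W(1) V)
    then have "gval (add_mset (gr_der a f) (W + (U - {#f#})))
        = ap (gr_prod (add_mset (gr_der a f) V + W1)) {#ap f {#}. f \<in># W0 + U0#}"
      using U W V by (simp only:) (rule gval_union, auto)
    also have "gr_prod (add_mset (gr_der a f) V + W1) = ?H * F"
      unfolding F_def by (rule gr_prod_union[OF W(2)])
    also have "{#ap f {#}. f \<in># W0 + U0#} = Y + Z"
      by (simp add: Y_def Z_def ev_image)
    also have "ap (?H * F) (Y + Z) = ap ?H (add_mset ?y Z)"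
    proof (rule ap_mult_union)
      have "ar ?H + size U1 = Suc (Suc (\<Sum>f\<in>#U1. ar f))"
        using ar_gr_prod[OF V_pos] V by simp
      with ar_gr_prod[OF U(2)] show "Suc (size Z) = ar ?H"
        unfolding GZ(2) by (simp add: G_def)
    qed (use FY in auto)
    finally show ?thesis by (simp add: V)
  qed
  have zero: "gval (add_mset (gr_der a f) (W + (U - {#f#})))
      = ap G (add_mset (tr a ?y (ev f)) (Z - {#ev f#}))" if f: "f \<in># U0" for f
  proof -
    obtain V where V: "U0 = add_mset f V" using multi_member_split[OF f] by blast
    have ar_f: "ar f = 0" using U(3) f by blast
    have "add_mset (gr_der a f) (W + (U - {#f#})) = add_mset (gr_der a f) (U1 + W1) + (W0 + V)"
      by (simp add: U(1) W(1) V)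
    then have "gval (add_mset (gr_der a f) (W + (U - {#f#})))
        = ap (gr_prod (add_mset (gr_der a f) (U1 + W1))) {#ap f {#}. f \<in># W0 + V#}"
      using U W V by (simp only:) (rule gval_union, auto)
    also have "gr_prod (add_mset (gr_der a f) (U1 + W1)) = G * (gr_der a f * F)"
      by (simp add: F_def G_def gr_prod_union[OF W(2)] mult.left_commute)
    also have "{#ap f {#}. f \<in># W0 + V#} = Y + (Z - {#ev f#})"
      by (simp add: Y_def Z_def V ev_image)
    also have "ap (G * (gr_der a f * F)) (Y + (Z - {#ev f#}))
        = ap G (add_mset (ap (gr_der a f * F) Y) (Z - {#ev f#}))"
      using FY GZ ar_f by (intro ap_mult_union) (simp_all add: ar_mult Z_def V)
    also have "ap (gr_der a f * F) Y = tr a ?y (ev f)"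
      using ap_mult_union[of Y F "{#}" "gr_der a f"] FY ar_f
      by (simp add: ap_gr_der lie_def ev_def)
    finally show ?thesis .
  qed
  define h where "h f = gval (add_mset (gr_der a f) (W + (U - {#f#})))" for f
  have "(\<Sum>f\<in>#U. h f) = (\<Sum>f\<in>#U1. h f) + (\<Sum>f\<in>#U0. h f)"
    by (simp add: U(1))
  also have "\<dots> = (\<Sum>f\<in>#U1. ap (gr_prod (add_mset (gr_der a f) (U1 - {#f#}))) (add_mset ?y Z))
        + (\<Sum>f\<in>#U0. ap G (add_mset (tr a ?y (ev f)) (Z - {#ev f#})))"
    unfolding h_def by (intro arg_cong2[where f = "(+)"] sum_mset_eqI pos zero)
  also have "(\<Sum>f\<in>#U1. ap (gr_prod (add_mset (gr_der a f) (U1 - {#f#}))) (add_mset ?y Z))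
      = ap (gr_der a G) (add_mset ?y Z)"
    unfolding G_def using U(2) GZ(2) by (intro gr_prod_leibniz[symmetric]) (simp_all add: G_def)
  also have "(\<Sum>f\<in>#U0. ap G (add_mset (tr a ?y (ev f)) (Z - {#ev f#})))
      = (\<Sum>z\<in>#Z. ap G (add_mset (tr a ?y z) (Z - {#z#})))"
    unfolding Z_def image_mset.compositionality comp_def ..
  also have "ap (gr_der a G) (add_mset ?y Z) + \<dots> = tr a ?y (ap G Z)"
    by (simp add: ap_gr_der lie_def)
  finally show ?thesis by (simp only: gW gU h_def)
qed


section \<open>From differential polynomials to values\<close>

definition pm_mset :: "('b \<Rightarrow>\<^sub>0 nat) \<Rightarrow> 'b multiset" where
  "pm_mset m = (\<Sum>v\<in>Poly_Mapping.keys m. replicate_mset (Poly_Mapping.lookup m v) v)"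

lemma count_pm_mset [simp]: "count (pm_mset m) v = Poly_Mapping.lookup m v"
  by (simp add: pm_mset_def count_sum sum.delta in_keys_iff)

lemma set_pm_mset [simp]: "set_mset (pm_mset m) = Poly_Mapping.keys m"
  by (auto simp: set_mset_def in_keys_iff)

lemma pm_mset_add [simp]: "pm_mset (m + n) = pm_mset m + pm_mset n"
  by (rule multiset_eqI) (simp add: lookup_add)

lemma pm_mset_single [simp]: "pm_mset (Poly_Mapping.single v (Suc 0)) = {#v#}"
  by (rule multiset_eqI) (simp add: lookup_single when_def)

lemma pm_mset_minus_single [simp]:
  "pm_mset (m - Poly_Mapping.single v (Suc 0)) = pm_mset m - {#v#}"
  by (rule multiset_eqI) (simp add: lookup_minus lookup_single when_def)

lemma pm_mset_zero [simp]: "pm_mset 0 = {#}"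
  by (simp add: pm_mset_def)

text \<open>Exponents enter \<open>cd_mder\<close> as scalars, while the Leibniz rule sums over
  factors with multiplicity. This translates between the two in any characteristic.\<close>

lemma scl_of_nat_sum_mset:
  assumes "finite S" "set_mset M \<subseteq> S"
  shows "(\<Sum>v\<in>S. scl (of_nat (count M v)) (f v)) = (\<Sum>v\<in>#M. f v)"
  using assms(2)
proof (induction M)
  case (add x M)
  have "(\<Sum>v\<in>S. scl (of_nat (count (add_mset x M) v)) (f v))
      = (\<Sum>v\<in>S. scl (of_nat (count M v)) (f v) + (if v = x then f v else 0))"
    by (intro sum.cong) (auto simp: scl_add_left scl_one)
  with add assms(1) show ?case
    by (simp add: sum.distrib sum.delta' add.commute)
qed simp

text \<open>The fold is independent of the order of the derivations by
  \<open>gr_der_commute\<close>.\<close>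

definition letter :: "('a, 'x) cd_index \<Rightarrow> ('k::field, 'a, 'x) gr" where
  "letter v = fold_mset gr_der (gen (abs_nov (Gen (fst v)))) (pm_mset (snd v))"

lemma comp_fun_commute_gr_der: "comp_fun_commute gr_der"
  by standard (simp add: fun_eq_iff gr_der_commute)

lemma letter_shift: "letter (cd_shift a v) = gr_der a (letter v)"
  by (cases v) (simp add: letter_def comp_fun_commute.fold_mset_add_mset[OF comp_fun_commute_gr_der])

lemma ar_letter:
  fixes v :: "('a, 'x) cd_index"
  shows "ar (letter v :: ('k::field, 'a, 'x) gr) = size (pm_mset (snd v))"
proof -
  have "ar (fold_mset gr_der f M) = ar f + size M" for f :: "('k, 'a, 'x) gr" and M
    by (induction M) (simp_all add: comp_fun_commute.fold_mset_add_mset[OF comp_fun_commute_gr_der])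
  then show ?thesis by (simp add: letter_def)
qed

definition mon_val :: "('a, 'x) cd_monom \<Rightarrow> ('k::field, 'a, 'x) nov" where
  "mon_val w = gval (image_mset letter (pm_mset w))"

definition poly_val :: "('k::field, 'a, 'x) cd_poly \<Rightarrow> ('k, 'a, 'x) nov" where
  "poly_val p = (\<Sum>w\<in>Poly_Mapping.keys p. scl (Poly_Mapping.lookup p w) (mon_val w))"

lemma poly_val_superset:
  assumes "finite S" "Poly_Mapping.keys p \<subseteq> S"
  shows "poly_val p = (\<Sum>w\<in>S. scl (Poly_Mapping.lookup p w) (mon_val w))"
  unfolding poly_val_def
  by (rule sum.mono_neutral_left) (use assms in \<open>auto simp: in_keys_iff\<close>)

lemma poly_val_add: "poly_val (p + q) = poly_val p + poly_val q"
proof -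
  let ?S = "Poly_Mapping.keys p \<union> Poly_Mapping.keys q"
  have "Poly_Mapping.keys (p + q) \<subseteq> ?S" by (rule Poly_Mapping.keys_add)
  then show ?thesis
    by (simp add: poly_val_superset[of ?S] lookup_add scl_add_left sum.distrib)
qed

lemma poly_val_zero [simp]: "poly_val 0 = 0"
  by (simp add: poly_val_def)

lemma poly_val_sum: "poly_val (sum f S) = (\<Sum>i\<in>S. poly_val (f i))"
  by (induction S rule: infinite_finite_induct) (simp_all add: poly_val_add)

lemma poly_val_single [simp]: "poly_val (Poly_Mapping.single w c) = scl c (mon_val w)"
  by (subst poly_val_superset[of "{w}"]) (auto split: if_splits)

lemma poly_val_smult: "poly_val (Poly_Mapping.single 0 c * p) = scl c (poly_val p)"
  by (induction p rule: cd_poly_induct)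
    (simp_all add: mult_single scl_mult distrib_left poly_val_add scl_add)

text \<open>This is weight -1, as the variable \<open>(x, m)\<close> has weight one less than the
  total degree of \<open>m\<close>.\<close>

definition mon_bal :: "('a, 'x) cd_monom \<Rightarrow> bool" where
  "mon_bal w \<longleftrightarrow> size (pm_mset w) = Suc (\<Sum>v\<in>#pm_mset w. size (pm_mset (snd v)))"

inductive_set bal :: "('k::field, 'a, 'x) cd_poly set" where
  zero: "0 \<in> bal"
| single: "mon_bal w \<Longrightarrow> Poly_Mapping.single w c \<in> bal"
| add: "p \<in> bal \<Longrightarrow> q \<in> bal \<Longrightarrow> p + q \<in> bal"

lemma bal_sum: "(\<And>i. i \<in> S \<Longrightarrow> f i \<in> bal) \<Longrightarrow> sum f S \<in> bal"
  by (induction S rule: infinite_finite_induct) (auto intro: bal.zero bal.add)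

lemma bal_smult: "p \<in> bal \<Longrightarrow> Poly_Mapping.single 0 c * p \<in> bal"
  by (induction rule: bal.induct) (auto simp: mult_single distrib_left intro: bal.intros)

lemma mon_bal_der:
  assumes "mon_bal w" "mon_bal u" "v \<in> Poly_Mapping.keys u"
  shows "mon_bal (w + (u - Poly_Mapping.single v 1 + Poly_Mapping.single (cd_shift a v) 1))"
proof -
  obtain M where M: "pm_mset u = add_mset v M"
    using assms(3) by (metis multi_member_split set_pm_mset)
  have "size (pm_mset (snd (cd_shift a v))) = Suc (size (pm_mset (snd v)))"
    by (cases v) simp
  with assms(1,2) M show ?thesis by (simp add: mon_bal_def)
qed

lemma single_mult_der:
  fixes c d :: "'k::field"
  assumes "mon_bal w" "mon_bal u"
  shows "Poly_Mapping.single w c * cd_der a (Poly_Mapping.single u d) \<in> bal \<and>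
    poly_val (Poly_Mapping.single w c * cd_der a (Poly_Mapping.single u d))
      = tr a (scl c (mon_val w)) (scl d (mon_val u))"
proof -
  define m where
    "m v = w + (u - Poly_Mapping.single v 1 + Poly_Mapping.single (cd_shift a v) 1)" for v
  have eq: "Poly_Mapping.single w c * cd_der a (Poly_Mapping.single u d)
    = (\<Sum>v\<in>Poly_Mapping.keys u.
        Poly_Mapping.single (m v) (c * d * of_nat (Poly_Mapping.lookup u v)))"
    by (simp add: cd_der_single cd_mder_def sum_distrib_left mult_single m_def mult.assoc)
  have "mon_val (m v) = gval (add_mset (gr_der a (letter v))
      (image_mset letter (pm_mset w) + (image_mset letter (pm_mset u) - {#letter v#})))"
    if v: "v \<in># pm_mset u" for v
  proof -
    obtain M where "pm_mset u = add_mset v M"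
      using multi_member_split[OF v] by blast
    then show ?thesis
      by (simp add: mon_val_def m_def letter_shift)
  qed
  then have "(\<Sum>v\<in>#pm_mset u. mon_val (m v) :: ('k, _, _) nov)
      = (\<Sum>v\<in>#pm_mset u. gval (add_mset (gr_der a (letter v))
          (image_mset letter (pm_mset w) + (image_mset letter (pm_mset u) - {#letter v#}))))"
    by (rule sum_mset_eqI)
  also have "\<dots> = (\<Sum>f\<in>#image_mset letter (pm_mset u). gval (add_mset (gr_der a f)
          (image_mset letter (pm_mset w) + (image_mset letter (pm_mset u) - {#f#}))))"
    by (simp add: image_mset.compositionality comp_def)
  also have "\<dots> = tr a (mon_val w) (mon_val u)"
    unfolding mon_val_def
    by (rule gval_tri)
      (use assms in \<open>simp_all add: mon_bal_def image_mset.compositionality comp_def ar_letter\<close>)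
  finally have "(\<Sum>v\<in>Poly_Mapping.keys u. scl (of_nat (Poly_Mapping.lookup u v)) (mon_val (m v)))
      = tr a (mon_val w) (mon_val u :: ('k, _, _) nov)"
    using scl_of_nat_sum_mset[of "Poly_Mapping.keys u" "pm_mset u" "\<lambda>v. mon_val (m v) :: ('k, _, _) nov"]
    by simp
  then have "poly_val (Poly_Mapping.single w c * cd_der a (Poly_Mapping.single u d))
      = tr a (scl c (mon_val w)) (scl d (mon_val u))"
    by (simp add: eq poly_val_sum scl_mult scl_sum[symmetric] tr_scl_left tr_scl_right
        scl_left_commute[of c d])
  moreover have "Poly_Mapping.single w c * cd_der a (Poly_Mapping.single u d) \<in> bal"
    unfolding eq m_def by (intro bal_sum bal.single mon_bal_der assms)
  ultimately show ?thesis by blast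
qed

lemma poly_val_tri:
  assumes "p \<in> bal" "q \<in> bal"
  shows "p * cd_der a q \<in> bal \<and> poly_val (p * cd_der a q) = tr a (poly_val p) (poly_val q)"
  using assms
proof (induction p rule: bal.induct)
  case zero
  then show ?case by (simp add: bal.zero)
next
  case (single w c)
  from single(2,1) show ?case
  proof (induction q rule: bal.induct)
    case zero
    then show ?case by (simp add: bal.zero cd_der_zero)
  next
    case (single u d)
    then show ?case using single_mult_der[of w u c a d] by simp
  next
    case (add p q)
    then show ?case
      by (simp add: cd_der_add distrib_left poly_val_add bal.add tr_add_right scl_add)
  qed
next
  case (add p q)
  then show ?case
    by (simp add: distrib_right poly_val_add bal.add tr_add_left)
qed

abbreviation cd_eval :: "'a set \<Rightarrow> 'x set \<Rightarrow> ('k::field, 'a, 'x) nov_term \<Rightarrow> ('k, 'a, 'x) cd_poly"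
  where "cd_eval A X \<equiv> nov_eval (canonical_novikov (CD A X)) cd_var"

text \<open>Here \<open>poly_val\<close> becomes the left inverse that yields injectivity.
  Membership in \<open>bal\<close> is carried through the induction because
  \<open>poly_val_tri\<close> assumes it.\<close>

lemma poly_val_cd_eval:
  fixes t :: "('k::field, 'a, 'x) nov_term"
  shows "cd_eval A X t \<in> bal \<and> poly_val (cd_eval A X t) = abs_nov t"
proof (induction t)
  case (Gen x)
  have "mon_bal (Poly_Mapping.single (x, 0 :: 'a \<Rightarrow>\<^sub>0 nat) 1)"
    by (simp add: mon_bal_def)
  \<comment> \<open>The only factor has arity 0, so the product of the others is
    \<open>gr_one\<close>, which returns its argument.\<close>
  moreover have "mon_val (Poly_Mapping.single (x, 0) 1) = (abs_nov (Gen x) :: ('k, 'a, 'x) nov)"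
    using gval_union[of "{#}" "{#letter (x, 0) :: ('k, 'a, 'x) gr#}"]
    by (simp add: ar_letter mon_val_def) (simp add: letter_def)
  ultimately show ?case
    by (simp add: cd_var_def cd_ivar_def bal.single scl_one)
next
  case Zero
  then show ?case
    by (simp add: canonical_novikov_def CD_def bal.zero zero_nov.abs_eq)
next
  case (Plus s t)
  then show ?case
    by (simp add: canonical_novikov_def CD_def bal.add poly_val_add plus_nov.abs_eq)
next
  case (Scale c t)
  then show ?case
    by (simp add: canonical_novikov_def CD_def bal_smult poly_val_smult scl.abs_eq)
next
  case (Tri a s t)
  then show ?case
    using poly_val_tri[of "cd_eval A X s" "cd_eval A X t" a]
    by (simp add: canonical_novikov_def CD_def tr.abs_eq)
qed

lemma cd_eval_eqD: "cd_eval A X s = cd_eval A X t \<Longrightarrow> nov_eq UNIV UNIV s t"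
  using poly_val_cd_eval[of A X s] poly_val_cd_eval[of A X t] nov.abs_eq_iff by metis


section \<open>Retraction onto the free algebra over subsets\<close>

text \<open>Indices outside \<open>A\<close> act as zero. This makes the algebra over \<open>UNIV\<close> retract onto the one
  over \<open>A\<close> and \<open>X\<close>.\<close>

lemma multi_novikov_extend:
  fixes V :: "('k::field, 'v, 'a) multi_alg"
  assumes "multi_novikov A V"
  shows "multi_novikov UNIV (V\<lparr>tri := \<lambda>a x y. if a \<in> A then tri V a x y else \<zero>\<^bsub>V\<^esub>\<rparr>)"
    (is "multi_novikov UNIV ?W")
proof -
  interpret multi_novikov A V by (rule assms)
  have W: "module field_ring ?W"
    using module_axioms
    by (simp add: module_def module_axioms_def abelian_group_def abelian_group_axioms_def
        abelian_monoid_def)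
  have minus: "x \<ominus>\<^bsub>?W\<^esub> y = x \<ominus>\<^bsub>V\<^esub> y" for x y
    by (simp add: a_minus_def a_inv_def)
  have tri_zero: "tri V a x \<zero>\<^bsub>V\<^esub> = \<zero>\<^bsub>V\<^esub>" "tri V a \<zero>\<^bsub>V\<^esub> x = \<zero>\<^bsub>V\<^esub>" if "a \<in> A" "x \<in> carrier V" for a x
    using tri_add_right[of a x "\<zero>\<^bsub>V\<^esub>" "\<zero>\<^bsub>V\<^esub>"] tri_add_left[of a "\<zero>\<^bsub>V\<^esub>" "\<zero>\<^bsub>V\<^esub>" x] tri_closed[of a] that
    by auto
  show ?thesis
  proof (rule multi_novikov.intro[OF W], rule multi_novikov_axioms.intro)
    fix a b x y z
    assume *: "x \<in> carrier ?W" "y \<in> carrier ?W" "z \<in> carrier ?W"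
    \<comment> \<open>Every term of the three identities involves both indices, so all terms vanish
      unless both lie in \<open>A\<close>.\<close>
    show "tri ?W b (tri ?W a x y) z \<ominus>\<^bsub>?W\<^esub> tri ?W a x (tri ?W b y z)
        = tri ?W b (tri ?W a y x) z \<ominus>\<^bsub>?W\<^esub> tri ?W a y (tri ?W b x z)"
      using * novikov1[of a b x y z] by (simp add: minus tri_zero)
    show "tri ?W b (tri ?W a x y) z \<ominus>\<^bsub>?W\<^esub> tri ?W a x (tri ?W b y z)
        = tri ?W a (tri ?W b x y) z \<ominus>\<^bsub>?W\<^esub> tri ?W b x (tri ?W a y z)"
      using * novikov2[of a b x y z] by (simp add: minus tri_zero)
    show "tri ?W b (tri ?W a x y) z = tri ?W a (tri ?W b x z) y"
      using * novikov3[of a b x y z] by (simp add: tri_zero)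
  qed (auto simp: tri_closed tri_add_left tri_add_right tri_smult_left tri_smult_right)
qed

text \<open>With generators outside \<open>X\<close> also sent to zero, evaluation in the extended
  \<open>Nov A X\<close> respects equivalence over \<open>UNIV\<close> and takes each term over
  \<open>A\<close> and \<open>X\<close> to its own class.\<close>

lemma nov_eq_restrict:
  fixes s t :: "('k::field, 'a, 'x) nov_term"
  assumes "nov_eq UNIV UNIV s t" and s: "s \<in> nov_terms A X" and t: "t \<in> nov_terms A X"
  shows "nov_eq A X s t"
proof -
  let ?N = "Nov A X :: ('k, _, 'a) multi_alg"
  let ?W = "?N\<lparr>tri := \<lambda>a x y. if a \<in> A then tri ?N a x y else \<zero>\<^bsub>?N\<^esub>\<rparr>"
  let ?f = "\<lambda>x. if x \<in> X then nov_gen A X x else \<zero>\<^bsub>?N\<^esub>"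
  interpret W: multi_novikov UNIV ?W
    by (rule multi_novikov_extend[OF Nov_multi_novikov])
  have f: "?f \<in> UNIV \<rightarrow> carrier ?W"
    by (simp add: nov_gen_def Nov_zero nov_class_closed nov_terms.intros)
  have eval: "nov_eval ?W ?f t = nov_class A X t" if "t \<in> nov_terms A X" for t
    using that by induction (simp_all add: nov_gen_def Nov_zero Nov_add Nov_smult Nov_tri)
  have "nov_class A X s = nov_class A X t"
    using W.nov_eval_eq[OF f assms(1)] by (simp add: eval s t)
  then show ?thesis
    using mem_nov_class_self[OF t] mem_nov_classD by fast
qed


section \<open>The isomorphism\<close>

lemma cd_eval_simps [simp]:
  "cd_eval A X Zero = 0"
  "cd_eval A X (Plus s t) = cd_eval A X s + cd_eval A X t"
  "cd_eval A X (Scale c s) = Poly_Mapping.single 0 c * cd_eval A X s"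
  "cd_eval A X (Tri a s t) = cd_eval A X s * cd_der a (cd_eval A X t)"
  by (simp_all add: canonical_novikov_def CD_def)

lemma canonical_CD_multi_novikov: "multi_novikov A (canonical_novikov (CD A X))"
  by (rule comm_multi_diff.canonical_multi_novikov[OF CD_comm_multi_diff])

lemma cd_var_closed: "cd_var \<in> X \<rightarrow> carrier (canonical_novikov (CD A X))"
  by (simp add: canonical_novikov_def CD_def cd_var_def cd_carrier_closed(5) cd_indices_def)

lemma carrier_generated_cd_var:
  "carrier (mn_generated A (canonical_novikov (CD A X :: ('k::field, _, 'a) multi_diff)) (cd_var ` X))
    = cd_eval A X ` nov_terms A X" (is "?G = ?E")
proof
  let ?V = "canonical_novikov (CD A X :: ('k, _, 'a) multi_diff)"
  interpret multi_novikov A ?V by (rule canonical_CD_multi_novikov)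
  have V: "module field_ring ?V" by unfold_locales
  have minus: "\<ominus>\<^bsub>?V\<^esub> x = (- 1) \<odot>\<^bsub>?V\<^esub> x" if "x \<in> carrier ?V" for x
    using module_minus_eq[OF V _ that, of "\<zero>\<^bsub>?V\<^esub>"] that smult_closed[of "- 1" x]
    by (simp add: a_minus_def)
  have "submodule ?E field_ring ?V"
  proof (rule submoduleI)
    show E: "?E \<subseteq> carrier ?V"
      using nov_eval_closed[OF cd_var_closed] by blast
    show "\<ominus>\<^bsub>?V\<^esub> x \<in> ?E" if x: "x \<in> ?E" for x
    proof -
      from x obtain t where t: "t \<in> nov_terms A X" "x = cd_eval A X t" by blast
      have "\<ominus>\<^bsub>?V\<^esub> x = cd_eval A X (Scale (- 1) t)"
        using minus[of x] x E t(2) by (auto simp del: cd_eval_simps)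
      with t(1) show ?thesis by (blast intro: nov_terms.intros)
    qed
    show "\<zero>\<^bsub>?V\<^esub> \<in> ?E"
      by (rule image_eqI[OF _ nov_terms.Zero]) (simp del: cd_eval_simps)
    show "x \<oplus>\<^bsub>?V\<^esub> y \<in> ?E" if xy: "x \<in> ?E" "y \<in> ?E" for x y
    proof -
      from xy obtain s t where "s \<in> nov_terms A X" "t \<in> nov_terms A X"
        "x = cd_eval A X s" "y = cd_eval A X t" by blast
      then show ?thesis
        by (intro image_eqI[of _ _ "Plus s t"] nov_terms.Plus) (simp_all del: cd_eval_simps)
    qed
    show "c \<odot>\<^bsub>?V\<^esub> x \<in> ?E" if x: "x \<in> ?E" for c x
    proof -
      from x obtain t where "t \<in> nov_terms A X" "x = cd_eval A X t" by blast
      then show ?thesis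
        by (intro image_eqI[of _ _ "Scale c t"] nov_terms.Scale) (simp_all del: cd_eval_simps)
    qed
  qed
  moreover have "tri ?V a x y \<in> ?E" if xy: "a \<in> A" "x \<in> ?E" "y \<in> ?E" for a x y
  proof -
    from xy obtain s t where "s \<in> nov_terms A X" "t \<in> nov_terms A X"
      "x = cd_eval A X s" "y = cd_eval A X t" by blast
    with xy(1) show ?thesis
      by (intro image_eqI[of _ _ "Tri a s t"] nov_terms.Tri) (simp_all del: cd_eval_simps)
  qed
  moreover have "cd_var ` X \<subseteq> ?E"
    by (auto intro!: image_eqI[OF _ nov_terms.Gen])
  ultimately have "mn_subalgebra A ?E ?V \<and> cd_var ` X \<subseteq> ?E"
    unfolding mn_subalgebra_def by blast
  then show "?G \<subseteq> ?E"
    unfolding mn_generated_def by auto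
  show "?E \<subseteq> ?G"
  proof -
    have "cd_eval A X t \<in> S"
      if t: "t \<in> nov_terms A X" and S: "mn_subalgebra A S ?V" "cd_var ` X \<subseteq> S" for t S
    proof -
      from S(1) have sub: "submodule S field_ring ?V"
        and tri: "\<And>a x y. a \<in> A \<Longrightarrow> x \<in> S \<Longrightarrow> y \<in> S \<Longrightarrow> tri ?V a x y \<in> S"
        by (auto simp: mn_subalgebra_def)
      interpret subgroup S "add_monoid ?V" by (rule submodule.axioms(1)[OF sub])
      from t show ?thesis
      proof induction
        case Zero
        then show ?case using one_closed by (simp del: cd_eval_simps)
      next
        case (Plus s t)
        then show ?case using m_closed by (simp del: cd_eval_simps)
      next
        case (Scale s c)
        then show ?case
          using submoduleE(4)[OF sub, of c "cd_eval A X s"] by (simp del: cd_eval_simps)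
      qed (use S(2) tri in \<open>auto simp del: cd_eval_simps\<close>)
    qed
    then show ?thesis unfolding mn_generated_def by auto
  qed
qed

theorem theorem3p3:
  fixes A :: "'a set" and X :: "'x set"
  shows "\<exists>\<phi> \<in> mn_iso A (Nov A X :: ('k::field, ('k, 'a, 'x) nov_term set, 'a) multi_alg)
                        (mn_generated A (canonical_novikov (CD A X)) (cd_var ` X)).
           \<forall>x\<in>X. \<phi> (nov_gen A X x) = cd_var x"
proof -
  let ?N = "Nov A X :: ('k, _, 'a) multi_alg"
  let ?V = "canonical_novikov (CD A X :: ('k, _, 'a) multi_diff)"
  let ?G = "mn_generated A ?V (cd_var ` X)"
  interpret multi_novikov A ?V by (rule canonical_CD_multi_novikov)
  have G: "carrier ?G = cd_eval A X ` nov_terms A X" by (rule carrier_generated_cd_var)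
  obtain h where h: "h \<in> mn_hom A ?N ?V" "\<forall>x\<in>X. h (nov_gen A X x) = cd_var x"
    using Nov_universal[OF canonical_CD_multi_novikov cd_var_closed] by blast
  have eval: "h (nov_class A X t) = cd_eval A X t" if "t \<in> nov_terms A X" for t
    using that
  proof induction
    case (Gen x)
    then show ?case using h(2) by (simp add: nov_gen_def)
  next
    case Zero
    \<comment> \<open>\<open>mn_hom\<close> does not mention zero; it is preserved as 0 times
      itself.\<close>
    have "h (0 \<odot>\<^bsub>?N\<^esub> nov_class A X Zero) = 0 \<odot>\<^bsub>?V\<^esub> h (nov_class A X Zero)"
      using h(1) nov_class_closed[OF nov_terms.Zero] unfolding mn_hom_def by blast
    moreover have "0 \<odot>\<^bsub>?N\<^esub> nov_class A X Zero = nov_class A X Zero"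
      using module.smult_r_null[OF Nov_module, of 0] by (simp add: Nov_zero)
    ultimately show ?case by (simp add: canonical_novikov_def CD_def)
  next
    case (Plus s t)
    then have "h (nov_class A X s \<oplus>\<^bsub>?N\<^esub> nov_class A X t)
        = h (nov_class A X s) \<oplus>\<^bsub>?V\<^esub> h (nov_class A X t)"
      using h(1) nov_class_closed unfolding mn_hom_def by blast
    with Plus show ?case by (simp add: Nov_add del: cd_eval_simps)
  next
    case (Scale s c)
    then have "h (c \<odot>\<^bsub>?N\<^esub> nov_class A X s) = c \<odot>\<^bsub>?V\<^esub> h (nov_class A X s)"
      using h(1) nov_class_closed unfolding mn_hom_def by blast
    with Scale show ?case by (simp add: Nov_smult del: cd_eval_simps)
  next
    case (Tri a s t)
    then have "h (tri ?N a (nov_class A X s) (nov_class A X t))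
        = tri ?V a (h (nov_class A X s)) (h (nov_class A X t))"
      using h(1) nov_class_closed unfolding mn_hom_def by blast
    with Tri show ?case by (simp add: Nov_tri del: cd_eval_simps)
  qed
  have "h \<in> mn_hom A ?N ?G"
  proof -
    have "h \<in> carrier ?N \<rightarrow> carrier ?G"
      unfolding G by (auto simp: Nov_carrier_iff eval)
    with h(1) show ?thesis
      by (simp add: mn_hom_def) (simp add: mn_generated_def)
  qed
  moreover have "bij_betw h (carrier ?N) (carrier ?G)"
    unfolding bij_betw_def
  proof
    show "inj_on h (carrier ?N)"
    proof (rule inj_onI)
      fix C D assume "C \<in> carrier ?N" "D \<in> carrier ?N" and eq: "h C = h D"
      then obtain s t where st: "s \<in> nov_terms A X" "t \<in> nov_terms A X"
        and C: "C = nov_class A X s" and D: "D = nov_class A X t"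
        by (auto simp: Nov_carrier_iff)
      from eq have "cd_eval A X s = cd_eval A X t" by (simp only: C D eval st)
      \<comment> \<open>The left inverse gives equivalence over \<open>UNIV\<close>, and the
        retraction brings it down to \<open>A\<close> and \<open>X\<close>.\<close>
      then have "nov_eq A X s t"
        using cd_eval_eqD nov_eq_restrict st by blast
      then show "C = D" unfolding C D by (rule nov_class_eqI)
    qed
    show "h ` carrier ?N = carrier ?G"
    proof -
      have "carrier ?N = nov_class A X ` nov_terms A X"
        by (auto simp: Nov_carrier_iff)
      then show ?thesis
        unfolding G by (simp add: image_image eval del: cd_eval_simps cong: image_cong_simp)
    qed
  qed
  ultimately show ?thesis
    using h(2) unfolding mn_iso_def by blast
qed

end
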